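(* There is a loop in the wedge sum $(S^1,1)\vee(S^1,1)$ that is quantum nullhomotopic, but not nullhomotopic in the ordinary sense.
   Context: $S^1\subseteq\mathbb{C}$ is the unit circle, $D^2$ is the unit disk, and $j\colon S^1\hookrightarrow D^2$ is the inclusion map. $(S^1,1)\vee(S^1,1)$ is the space obtained from two disjoint copies of $S^1$ by identifying the two points $1$. For a compact Hausdorff space $X$, $C(X)$ is the C*-algebra of continuous complex-valued functions on $X$, and for a continuous map $g\colon X \to Y$, $g^\star\colon C(Y)\to C(X)$ is $a\mapsto a\circ g$. A loop in a compact Hausdorff space $T$ is a continuous function $f\colon S^1\to T$; it is nullhomotopic (in the ordinary sense) if it extends to a continuous function $D^2\to T$. A loop $f$ in $T$ is quantum nullhomotopic if there is a nonzero finite-dimensional (complex) Hilbert space $H$ and a unital $*$-homomorphism $\phi\colon C(T)\to C(D^2)\otimes L(H)$ such that $(j^\star\otimes\mathrm{id})(\phi(a)) = f^\star(a)\otimes 1_H$ for all $a\in C(T)$, where $L(H)$ is the C*-algebra of linear operators on $H$ and $\otimes$ is the tensor product of C*-algebras. *)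

theory Defs
  imports "HOL-Analysis.Analysis" "Jordan_Normal_Form.Schur_Decomposition"
begin

section \<open>Unital C*-algebras\<close>

record 'a cstar = "(complex, 'a) module" +
  adj :: "'a \<Rightarrow> 'a"
  nrm :: "'a \<Rightarrow> real"

locale cstar_algebra = ring A for A :: "('a, 'm) cstar_scheme" (structure) +
  assumes smult_closed: "x \<in> carrier A \<Longrightarrow> c \<odot> x \<in> carrier A"
    and smult_l_distr: "x \<in> carrier A \<Longrightarrow> (c + d) \<odot> x = c \<odot> x \<oplus> d \<odot> x"
    and smult_r_distr: "\<lbrakk>x \<in> carrier A; y \<in> carrier A\<rbrakk> \<Longrightarrow> c \<odot> (x \<oplus> y) = c \<odot> x \<oplus> c \<odot> y"
    and smult_assoc: "x \<in> carrier A \<Longrightarrow> (c * d) \<odot> x = c \<odot> (d \<odot> x)"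
    and smult_one: "x \<in> carrier A \<Longrightarrow> 1 \<odot> x = x"
    and smult_mult_l: "\<lbrakk>x \<in> carrier A; y \<in> carrier A\<rbrakk> \<Longrightarrow> (c \<odot> x) \<otimes> y = c \<odot> (x \<otimes> y)"
    and smult_mult_r: "\<lbrakk>x \<in> carrier A; y \<in> carrier A\<rbrakk> \<Longrightarrow> x \<otimes> (c \<odot> y) = c \<odot> (x \<otimes> y)"
    and adj_closed: "x \<in> carrier A \<Longrightarrow> adj A x \<in> carrier A"
    and adj_adj: "x \<in> carrier A \<Longrightarrow> adj A (adj A x) = x"
    and adj_add: "\<lbrakk>x \<in> carrier A; y \<in> carrier A\<rbrakk> \<Longrightarrow> adj A (x \<oplus> y) = adj A x \<oplus> adj A y"
    and adj_smult: "x \<in> carrier A \<Longrightarrow> adj A (c \<odot> x) = cnj c \<odot> adj A x"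
    and adj_mult: "\<lbrakk>x \<in> carrier A; y \<in> carrier A\<rbrakk> \<Longrightarrow> adj A (x \<otimes> y) = adj A y \<otimes> adj A x"
    and nrm_nonneg: "x \<in> carrier A \<Longrightarrow> 0 \<le> nrm A x"
    and nrm_eq_0: "x \<in> carrier A \<Longrightarrow> nrm A x = 0 \<longleftrightarrow> x = \<zero>"
    and nrm_triangle: "\<lbrakk>x \<in> carrier A; y \<in> carrier A\<rbrakk> \<Longrightarrow> nrm A (x \<oplus> y) \<le> nrm A x + nrm A y"
    and nrm_smult: "x \<in> carrier A \<Longrightarrow> nrm A (c \<odot> x) = cmod c * nrm A x"
    and nrm_mult: "\<lbrakk>x \<in> carrier A; y \<in> carrier A\<rbrakk> \<Longrightarrow> nrm A (x \<otimes> y) \<le> nrm A x * nrm A y"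
    and nrm_adj_mult: "x \<in> carrier A \<Longrightarrow> nrm A (adj A x \<otimes> x) = (nrm A x)\<^sup>2"
    and complete: "\<lbrakk>\<And>k::nat. s k \<in> carrier A;
        \<And>e. e > 0 \<Longrightarrow> \<exists>N. \<forall>k\<ge>N. \<forall>l\<ge>N. nrm A (s k \<ominus> s l) < e\<rbrakk>
        \<Longrightarrow> \<exists>x\<in>carrier A. (\<lambda>k. nrm A (s k \<ominus> x)) \<longlonglongrightarrow> 0"

(* ring_hom already requires preservation of the unit. *)
definition star_hom :: "('a, 'm) cstar_scheme \<Rightarrow> ('b, 'k) cstar_scheme \<Rightarrow> ('a \<Rightarrow> 'b) set" where
  "star_hom A B = {h \<in> Ring.ring_hom A B.
     (\<forall>c. \<forall>x\<in>carrier A. h (c \<odot>\<^bsub>A\<^esub> x) = c \<odot>\<^bsub>B\<^esub> h x) \<and>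
     (\<forall>x\<in>carrier A. h (adj A x) = adj B (h x))}"

definition lin_indep_family :: "('a, 'm) cstar_scheme \<Rightarrow> nat \<Rightarrow> (nat \<Rightarrow> 'a) \<Rightarrow> bool" where
  "lin_indep_family A k b \<longleftrightarrow>
     (\<forall>c. (\<Oplus>\<^bsub>A\<^esub>i\<in>{..<k}. c i \<odot>\<^bsub>A\<^esub> b i) = \<zero>\<^bsub>A\<^esub> \<longrightarrow> (\<forall>i<k. c i = 0))"

(* P, together with the bilinear map t of elementary tensors, is a C*-tensor product of A and B,
   i.e. a completion of the algebraic tensor product of the *-algebras A and B in a C*-norm.
   The axiom inj says that the *-homomorphism that t induces on the algebraic tensor product is
   injective: each element of the algebraic tensor product is a sum of elementary tensors of u i and v i
   with linearly independent v i.  If B is finite-dimensional (more generally, nuclear), the C*-norm is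
   unique, and (P, t) is determined up to a unique isomorphism. *)
locale cstar_tensor = A: cstar_algebra A + B: cstar_algebra B + P: cstar_algebra P
  for A :: "('a, 'm) cstar_scheme" and B :: "('b, 'k) cstar_scheme"
    and P :: "('p, 'l) cstar_scheme" and t :: "'a \<Rightarrow> 'b \<Rightarrow> 'p" +
  assumes closed: "\<lbrakk>a \<in> carrier A; b \<in> carrier B\<rbrakk> \<Longrightarrow> t a b \<in> carrier P"
    and add_l: "\<lbrakk>a \<in> carrier A; a' \<in> carrier A; b \<in> carrier B\<rbrakk>
      \<Longrightarrow> t (a \<oplus>\<^bsub>A\<^esub> a') b = t a b \<oplus>\<^bsub>P\<^esub> t a' b"
    and add_r: "\<lbrakk>a \<in> carrier A; b \<in> carrier B; b' \<in> carrier B\<rbrakk>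
      \<Longrightarrow> t a (b \<oplus>\<^bsub>B\<^esub> b') = t a b \<oplus>\<^bsub>P\<^esub> t a b'"
    and smult_l: "\<lbrakk>a \<in> carrier A; b \<in> carrier B\<rbrakk> \<Longrightarrow> t (c \<odot>\<^bsub>A\<^esub> a) b = c \<odot>\<^bsub>P\<^esub> t a b"
    and smult_r: "\<lbrakk>a \<in> carrier A; b \<in> carrier B\<rbrakk> \<Longrightarrow> t a (c \<odot>\<^bsub>B\<^esub> b) = c \<odot>\<^bsub>P\<^esub> t a b"
    and mult: "\<lbrakk>a \<in> carrier A; a' \<in> carrier A; b \<in> carrier B; b' \<in> carrier B\<rbrakk>
      \<Longrightarrow> t a b \<otimes>\<^bsub>P\<^esub> t a' b' = t (a \<otimes>\<^bsub>A\<^esub> a') (b \<otimes>\<^bsub>B\<^esub> b')"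
    and adj: "\<lbrakk>a \<in> carrier A; b \<in> carrier B\<rbrakk> \<Longrightarrow> adj P (t a b) = t (adj A a) (adj B b)"
    and inj: "\<lbrakk>\<And>i. i < k \<Longrightarrow> u i \<in> carrier A; \<And>i. i < k \<Longrightarrow> v i \<in> carrier B;
        lin_indep_family B k v; (\<Oplus>\<^bsub>P\<^esub>i\<in>{..<k}. t (u i) (v i)) = \<zero>\<^bsub>P\<^esub>; i < k\<rbrakk>
      \<Longrightarrow> u i = \<zero>\<^bsub>A\<^esub>"
    and dense: "\<lbrakk>x \<in> carrier P; e > 0\<rbrakk> \<Longrightarrow> \<exists>k u v.
        (\<forall>i<k. u i \<in> carrier A \<and> v i \<in> carrier B) \<and>
        nrm P (x \<ominus>\<^bsub>P\<^esub> (\<Oplus>\<^bsub>P\<^esub>i\<in>{..<k::nat}. t (u i) (v i))) < e"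


section \<open>The C*-algebras C(X) and L(H)\<close>

(* Elements are extensional functions, so that equality is equality on the space X. *)
definition C_alg :: "'a topology \<Rightarrow> ('a \<Rightarrow> complex) cstar" where
  "C_alg X = \<lparr>
     carrier = {a \<in> extensional (topspace X). continuous_map X euclidean a},
     mult = (\<lambda>a b. \<lambda>x\<in>topspace X. a x * b x),
     one = (\<lambda>x\<in>topspace X. 1),
     zero = (\<lambda>x\<in>topspace X. 0),
     add = (\<lambda>a b. \<lambda>x\<in>topspace X. a x + b x),
     smult = (\<lambda>c a. \<lambda>x\<in>topspace X. c * a x),
     adj = (\<lambda>a. \<lambda>x\<in>topspace X. cnj (a x)),
     nrm = (\<lambda>a. Sup (insert 0 ((\<lambda>x. cmod (a x)) ` topspace X)))\<rparr>"

definition pullback :: "'a topology \<Rightarrow> ('a \<Rightarrow> 'b) \<Rightarrow> ('b \<Rightarrow> complex) \<Rightarrow> ('a \<Rightarrow> complex)" where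
  "pullback X g a = restrict (a \<circ> g) (topspace X)"

definition cvec_norm :: "complex vec \<Rightarrow> real" where
  "cvec_norm v = sqrt (Re (v \<bullet>c v))"

(* Linear operators on the Hilbert space C^n, given by their matrices, with the operator norm. *)
definition L_alg :: "nat \<Rightarrow> complex mat cstar" where
  "L_alg n = \<lparr>
     carrier = carrier_mat n n,
     mult = (*),
     one = 1\<^sub>m n,
     zero = 0\<^sub>m n n,
     add = (+),
     smult = (\<cdot>\<^sub>m),
     adj = mat_adjoint,
     nrm = (\<lambda>S. SUP v\<in>{v \<in> carrier_vec n. cvec_norm v \<le> 1}. cvec_norm (S *\<^sub>v v))\<rparr>"


section \<open>Loops\<close>

abbreviation S1 :: "complex topology" where
  "S1 \<equiv> top_of_set (sphere 0 1)"

abbreviation D2 :: "complex topology" where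
  "D2 \<equiv> top_of_set (cball 0 1)"

definition loop_in :: "'a topology \<Rightarrow> (complex \<Rightarrow> 'a) \<Rightarrow> bool" where
  "loop_in T f \<longleftrightarrow> continuous_map S1 T f"

definition nullhomotopic_loop :: "'a topology \<Rightarrow> (complex \<Rightarrow> 'a) \<Rightarrow> bool" where
  "nullhomotopic_loop T f \<longleftrightarrow>
     (\<exists>g. continuous_map D2 T g \<and> (\<forall>z\<in>topspace S1. g z = f z))"

(* H is C^n with n > 0.  (P, tD) and (Q, tS) are the tensor products of L(H) with C(D2) and with
   C(S1); by uniqueness of these, it does not matter which ones are taken, nor on which type they
   are carried.  r is the *-homomorphism that is the tensor product of the restriction map from
   C(D2) to C(S1) and the identity of L(H): its values on elementary tensors determine it. *)
definition quantum_nullhomotopic :: "'a topology \<Rightarrow> (complex \<Rightarrow> 'a) \<Rightarrow> bool" where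
  "quantum_nullhomotopic T f \<longleftrightarrow>
     (\<exists>n>0. \<exists>(P :: (complex \<Rightarrow> complex mat) cstar) tD (Q :: (complex \<Rightarrow> complex mat) cstar) tS r \<phi>.
        cstar_tensor (C_alg D2) (L_alg n) P tD \<and>
        cstar_tensor (C_alg S1) (L_alg n) Q tS \<and>
        r \<in> star_hom P Q \<and>
        (\<forall>a\<in>carrier (C_alg D2). \<forall>S\<in>carrier (L_alg n). r (tD a S) = tS (pullback S1 id a) S) \<and>
        \<phi> \<in> star_hom (C_alg T) P \<and>
        (\<forall>a\<in>carrier (C_alg T). r (\<phi> a) = tS (pullback S1 f a) \<one>\<^bsub>L_alg n\<^esub>))"


section \<open>Wedge sums\<close>

definition wedge_rel :: "('i \<Rightarrow> 'a topology) \<Rightarrow> ('i \<Rightarrow> 'a) \<Rightarrow> 'i set \<Rightarrow> (('i \<times> 'a) \<times> ('i \<times> 'a)) set" where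
  "wedge_rel X p I = {(u, v). u \<in> topspace (sum_topology X I) \<and> v \<in> topspace (sum_topology X I) \<and>
     (u = v \<or> snd u = p (fst u) \<and> snd v = p (fst v))}"

(* The wedge sum of the pointed spaces (X i, p i): the set of equivalence classes of points of the
   disjoint union, with the quotient topology. *)
definition wedge_sum :: "('i \<Rightarrow> 'a topology) \<Rightarrow> ('i \<Rightarrow> 'a) \<Rightarrow> 'i set \<Rightarrow> ('i \<times> 'a) set topology" where
  "wedge_sum X p I = topology (\<lambda>U. U \<subseteq> topspace (sum_topology X I) // wedge_rel X p I \<and>
     openin (sum_topology X I) {u \<in> topspace (sum_topology X I). wedge_rel X p I `` {u} \<in> U})"

abbreviation S1_wedge_S1 :: "(bool \<times> complex) set topology" where
  "S1_wedge_S1 \<equiv> wedge_sum (\<lambda>_. S1) (\<lambda>_. 1) UNIV"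

lemma equiv_wedge_rel: "equiv (topspace (sum_topology X I)) (wedge_rel X p I)"
  unfolding wedge_rel_def equiv_def refl_on_def sym_def trans_def by auto

lemma openin_wedge_sum:
  "openin (wedge_sum X p I) U \<longleftrightarrow> U \<subseteq> topspace (sum_topology X I) // wedge_rel X p I \<and>
     openin (sum_topology X I) {u \<in> topspace (sum_topology X I). wedge_rel X p I `` {u} \<in> U}"
proof -
  let ?S = "sum_topology X I" and ?q = "\<lambda>u. wedge_rel X p I `` {u}"
  have "istopology (\<lambda>U. U \<subseteq> topspace ?S // wedge_rel X p I \<and> openin ?S {u \<in> topspace ?S. ?q u \<in> U})"
    unfolding istopology_def
  proof (intro conjI allI impI)
    fix U V assume "U \<subseteq> topspace ?S // wedge_rel X p I \<and> openin ?S {u \<in> topspace ?S. ?q u \<in> U}"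
      "V \<subseteq> topspace ?S // wedge_rel X p I \<and> openin ?S {u \<in> topspace ?S. ?q u \<in> V}"
    then have UV: "U \<inter> V \<subseteq> topspace ?S // wedge_rel X p I"
      "openin ?S ({u \<in> topspace ?S. ?q u \<in> U} \<inter> {u \<in> topspace ?S. ?q u \<in> V})"
      by (blast, intro openin_Int) simp_all
    moreover have "{u \<in> topspace ?S. ?q u \<in> U \<inter> V} = {u \<in> topspace ?S. ?q u \<in> U} \<inter> {u \<in> topspace ?S. ?q u \<in> V}"
      by blast
    ultimately show "U \<inter> V \<subseteq> topspace ?S // wedge_rel X p I" "openin ?S {u \<in> topspace ?S. ?q u \<in> U \<inter> V}"
      by simp_all
  next
    fix K assume K: "\<forall>U\<in>K. U \<subseteq> topspace ?S // wedge_rel X p I \<and> openin ?S {u \<in> topspace ?S. ?q u \<in> U}"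
    then show "\<Union>K \<subseteq> topspace ?S // wedge_rel X p I" by blast
    have "{u \<in> topspace ?S. ?q u \<in> \<Union>K} = (\<Union>U\<in>K. {u \<in> topspace ?S. ?q u \<in> U})" by blast
    then show "openin ?S {u \<in> topspace ?S. ?q u \<in> \<Union>K}" using K by (auto intro!: openin_Union simp del: topspace_sum_topology)
  qed
  then show ?thesis unfolding wedge_sum_def by (simp only: topology_inverse')
qed

lemma quotient_map_wedge_sum:
  "quotient_map (sum_topology X I) (wedge_sum X p I) (\<lambda>u. wedge_rel X p I `` {u})"
proof -
  let ?S = "sum_topology X I"
  have o: "openin (wedge_sum X p I) (topspace ?S // wedge_rel X p I)"
  proof -
    have "{u \<in> topspace ?S. wedge_rel X p I `` {u} \<in> topspace ?S // wedge_rel X p I} = topspace ?S"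
      by (auto intro: quotientI simp del: topspace_sum_topology)
    then show ?thesis unfolding openin_wedge_sum using openin_topspace by (metis subset_refl)
  qed
  moreover have "topspace (wedge_sum X p I) \<subseteq> topspace ?S // wedge_rel X p I"
    using openin_wedge_sum[of X p I "topspace (wedge_sum X p I)"] by simp
  ultimately have t: "topspace (wedge_sum X p I) = topspace ?S // wedge_rel X p I"
    using openin_subset by blast
  have "(\<lambda>u. wedge_rel X p I `` {u}) ` topspace ?S = topspace (wedge_sum X p I)"
    unfolding t quotient_def by blast
  then show ?thesis unfolding quotient_map_def openin_wedge_sum t by blast
qed

lemma compact_space_S1_wedge_S1: "compact_space S1_wedge_S1"
proof -
  let ?S = "sum_topology (\<lambda>_::bool. S1) UNIV"
  have "compactin ?S ((\<lambda>x. (b, x)) ` topspace S1)" for b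
    by (rule image_compactin[OF _ continuous_map_component_injection]) (auto simp: compactin_subtopology)
  then have "compactin ?S (((\<lambda>x. (True, x)) ` topspace S1) \<union> ((\<lambda>x. (False, x)) ` topspace S1))"
    by (intro compactin_Un) auto
  moreover have "((\<lambda>x. (True, x)) ` topspace S1) \<union> ((\<lambda>x. (False, x)) ` topspace S1) = topspace ?S"
    by (auto simp: image_iff)
  ultimately have "compact_space ?S" by (simp add: compact_space_def)
  then show ?thesis
    using image_compactin[OF _ quotient_imp_continuous_map] quotient_imp_surjective_map
      quotient_map_wedge_sum[of "\<lambda>_::bool. S1" UNIV "\<lambda>_. 1"]
    unfolding compact_space_def by metis
qed

lemma Hausdorff_space_S1_wedge_S1: "Hausdorff_space S1_wedge_S1"
proof -
  let ?S = "sum_topology (\<lambda>_::bool. S1) UNIV"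
  let ?q = "\<lambda>u. wedge_rel (\<lambda>_::bool. S1) (\<lambda>_. 1) UNIV `` {u}"
  define g where "g u = (if fst u then (snd u, 1) else (1, snd u))" for u :: "bool \<times> complex"
  define h where "h C = g (SOME u. u \<in> C)" for C
  have q: "quotient_map ?S S1_wedge_S1 ?q" by (rule quotient_map_wedge_sum)
  have hq: "h (?q u) = g u" if "u \<in> topspace ?S" for u
  proof -
    have "u \<in> ?q u" using that by (auto simp: wedge_rel_def)
    then have "(SOME v. v \<in> ?q u) \<in> ?q u" by (rule someI)
    then show ?thesis unfolding h_def g_def by (auto simp: wedge_rel_def split: if_splits)
  qed
  have "continuous_map ?S euclidean g"
  proof -
    have "continuous_map S1 euclidean (\<lambda>x. g (b, x))" for b
      by (cases b) (auto simp: g_def intro!: continuous_intros)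
    show ?thesis unfolding continuous_map_def
    proof (intro conjI allI impI)
      fix U :: "(complex \<times> complex) set" assume "openin euclidean U"
      then have "openin S1 {x \<in> topspace S1. g (b, x) \<in> U}" for b
        using openin_continuous_map_preimage[OF \<open>\<And>b. continuous_map S1 euclidean (\<lambda>x. g (b, x))\<close>] by blast
      then show "openin ?S {u \<in> topspace ?S. g u \<in> U}"
        unfolding openin_sum_topology by auto
    qed simp
  qed
  then have "continuous_map ?S euclidean (h \<circ> ?q)"
    by (rule continuous_map_eq) (use hq in auto)
  then have "continuous_map S1_wedge_S1 euclidean h"
    using continuous_compose_quotient_map[OF q] by blast
  moreover have "inj_on h (topspace S1_wedge_S1)"
  proof (rule inj_onI)
    fix C D assume "C \<in> topspace S1_wedge_S1" "D \<in> topspace S1_wedge_S1" and e: "h C = h D"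
    then obtain u v where u: "u \<in> topspace ?S" "C = ?q u" and v: "v \<in> topspace ?S" "D = ?q v"
      using quotient_imp_surjective_map[OF q] by (metis (no_types, lifting) imageE)
    have "g u = g v" using e hq u v by simp
    then have "u = v \<or> snd u = 1 \<and> snd v = 1"
      by (auto simp: g_def prod_eq_iff split: if_splits)
    then have "(u, v) \<in> wedge_rel (\<lambda>_::bool. S1) (\<lambda>_. 1) UNIV" using u v by (auto simp: wedge_rel_def)
    then show "C = D" using u v equiv_class_eq[OF equiv_wedge_rel] by blast
  qed
  ultimately show ?thesis
    by (rule Hausdorff_space_injective_preimage[OF Hausdorff_space_euclidean])
qed


section \<open>Existence of the tensor products of C(X) and L(H)\<close>

context cstar_algebra begin

lemma nrm_zero: "nrm A \<zero> = 0"
  using nrm_eq_0 by blast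

lemma smult_zero: "x \<in> carrier A \<Longrightarrow> 0 \<odot> x = \<zero>"
  by (metis add.r_cancel_one' smult_closed smult_l_distr add.right_neutral)

lemma smult_zero_r: "c \<odot> \<zero> = \<zero>"
  by (metis smult_zero mult_zero_right smult_assoc zero_closed)

lemma smult_minus: "x \<in> carrier A \<Longrightarrow> (-1) \<odot> x = \<ominus> x"
proof -
  assume x: "x \<in> carrier A"
  have "(-1) \<odot> x \<oplus> x = (-1 + 1) \<odot> x"
    using x by (metis smult_l_distr smult_one)
  then have "(-1) \<odot> x \<oplus> x = \<zero>" using smult_zero x by simp
  then show ?thesis using x smult_closed minus_equality by metis
qed

lemma nrm_minus: "x \<in> carrier A \<Longrightarrow> nrm A (\<ominus> x) = nrm A x"
  using nrm_smult[of x "-1"] smult_minus by simp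

lemma nrm_diff_triangle: 
  assumes "x \<in> carrier A" "y \<in> carrier A" "z \<in> carrier A"
  shows "nrm A (x \<ominus> z) \<le> nrm A (x \<ominus> y) + nrm A (y \<ominus> z)"
proof -
  have "x \<ominus> z = (x \<ominus> y) \<oplus> (y \<ominus> z)" using assms 
    by (simp add: a_minus_def a_assoc add.inv_solve_left' add.m_assoc r_neg1)
  then show ?thesis using assms nrm_triangle by simp
qed

lemma nrm_diff_commute: 
  assumes "x \<in> carrier A" "y \<in> carrier A" shows "nrm A (x \<ominus> y) = nrm A (y \<ominus> x)"
proof -
  have "x \<ominus> y = \<ominus> (y \<ominus> x)" using assms 
    by (simp add: a_minus_def minus_add a_comm)
  then show ?thesis using assms nrm_minus by simp
qed

lemma nrm_le_diff:
  assumes "x \<in> carrier A" "y \<in> carrier A" shows "nrm A x \<le> nrm A (x \<ominus> y) + nrm A y"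
  using nrm_diff_triangle[of x y \<zero>] assms by (simp add: a_minus_def)

lemma nrm_adj_le:
  assumes "x \<in> carrier A" shows "nrm A x \<le> nrm A (adj A x)"
proof (cases "nrm A x = 0")
  case True then show ?thesis using nrm_nonneg adj_closed assms by simp
next
  case False
  then have p: "nrm A x > 0" using nrm_nonneg[OF assms] by simp
  have "nrm A x * nrm A x \<le> nrm A (adj A x) * nrm A x"
    using nrm_mult[OF adj_closed[OF assms] assms] nrm_adj_mult[OF assms] by (simp add: power2_eq_square)
  then show ?thesis using p by simp
qed

lemma nrm_adj: "x \<in> carrier A \<Longrightarrow> nrm A (adj A x) = nrm A x"
  using nrm_adj_le[of x] nrm_adj_le[of "adj A x"] adj_adj adj_closed by fastforce

lemma adj_diff: 
  assumes "x \<in> carrier A" "y \<in> carrier A" shows "adj A (x \<ominus> y) = adj A x \<ominus> adj A y"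
proof -
  have "adj A (\<ominus> y) = \<ominus> adj A y" using adj_smult[of y "-1"] smult_minus adj_closed assms by simp
  then show ?thesis using assms by (simp add: a_minus_def adj_add)
qed

lemma smult_diff: 
  assumes "x \<in> carrier A" "y \<in> carrier A" shows "c \<odot> (x \<ominus> y) = c \<odot> x \<ominus> c \<odot> y"
proof -
  have "c \<odot> (\<ominus> y) = \<ominus> (c \<odot> y)" 
    using smult_minus[of y] smult_minus[of "c \<odot> y"] smult_assoc[of y c "-1"] smult_assoc[of y "-1" c] smult_closed assms by simp
  then show ?thesis using assms by (simp add: a_minus_def smult_r_distr)
qed

lemma add_diff:
  assumes "x \<in> carrier A" "y \<in> carrier A" "u \<in> carrier A" "v \<in> carrier A"
  shows "(x \<oplus> y) \<ominus> (u \<oplus> v) = (x \<ominus> u) \<oplus> (y \<ominus> v)"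
  using assms by (simp add: a_minus_def minus_add a_ac)

lemma mult_diff:
  assumes "x \<in> carrier A" "y \<in> carrier A" "u \<in> carrier A" "v \<in> carrier A"
  shows "(x \<otimes> y) \<ominus> (u \<otimes> v) = ((x \<ominus> u) \<otimes> y) \<oplus> (u \<otimes> (y \<ominus> v))"
proof -
  have "(x \<otimes> y) \<ominus> (u \<otimes> v) = ((x \<otimes> y) \<ominus> (u \<otimes> y)) \<oplus> ((u \<otimes> y) \<ominus> (u \<otimes> v))"
    using assms by (simp add: a_minus_def a_assoc r_neg1)
  then show ?thesis using assms by (simp add: a_minus_def l_distr r_distr l_minus r_minus)
qed

lemma smult_diff_l: 
  assumes "x \<in> carrier A" shows "(c - d) \<odot> x = c \<odot> x \<ominus> d \<odot> x"
  using assms smult_l_distr[of x c "-d"] smult_minus[of "d \<odot> x"] smult_assoc[of x "-1" d] smult_closed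
  by (simp add: a_minus_def)

lemma minus_eq_zero_iff: 
  assumes "x \<in> carrier A" "y \<in> carrier A" shows "x \<ominus> y = \<zero> \<longleftrightarrow> x = y"
  by (metis assms a_minus_def add.inv_solve_right' add.inv_closed l_zero zero_closed r_neg)

end

(* The C*-algebra of continuous B-valued functions; the case B = L(H) gives the tensor product
   of C(X) and L(H), see cstar_tensor_cont_alg. *)
definition cont_alg :: "'a topology \<Rightarrow> ('b, 'm) cstar_scheme \<Rightarrow> ('a \<Rightarrow> 'b) cstar" where
  "cont_alg X B = \<lparr>
     carrier = {F \<in> topspace X \<rightarrow>\<^sub>E carrier B.
       \<forall>x\<in>topspace X. ((\<lambda>y. nrm B (F y \<ominus>\<^bsub>B\<^esub> F x)) \<longlongrightarrow> 0) (atin X x)},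
     mult = (\<lambda>F G. \<lambda>x\<in>topspace X. F x \<otimes>\<^bsub>B\<^esub> G x),
     one = (\<lambda>x\<in>topspace X. \<one>\<^bsub>B\<^esub>),
     zero = (\<lambda>x\<in>topspace X. \<zero>\<^bsub>B\<^esub>),
     add = (\<lambda>F G. \<lambda>x\<in>topspace X. F x \<oplus>\<^bsub>B\<^esub> G x),
     smult = (\<lambda>c F. \<lambda>x\<in>topspace X. c \<odot>\<^bsub>B\<^esub> F x),
     adj = (\<lambda>F. \<lambda>x\<in>topspace X. adj B (F x)),
     nrm = (\<lambda>F. Sup (insert 0 ((\<lambda>x. nrm B (F x)) ` topspace X)))\<rparr>"

locale cont_alg_loc = cstar_algebra B for B :: "('b, 'm) cstar_scheme" (structure) +
  fixes X :: "'a topology"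
  assumes cpt: "compact_space X"
begin

abbreviation "P \<equiv> cont_alg X B"
abbreviation "T \<equiv> topspace X"

lemma P_carrier_val: "F \<in> carrier P \<Longrightarrow> x \<in> T \<Longrightarrow> F x \<in> carrier B"
  by (auto simp: cont_alg_def)

lemma P_carrier_lim: "F \<in> carrier P \<Longrightarrow> x \<in> T \<Longrightarrow> ((\<lambda>y. nrm B (F y \<ominus> F x)) \<longlongrightarrow> 0) (atin X x)"
  by (auto simp: cont_alg_def)

lemma P_ext: "F \<in> carrier P \<Longrightarrow> G \<in> carrier P \<Longrightarrow> (\<And>x. x \<in> T \<Longrightarrow> F x = G x) \<Longrightarrow> F = G"
  unfolding cont_alg_def by (auto intro: PiE_ext)

lemma ev_top: "eventually (\<lambda>y. y \<in> T) (atin X x)"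
  unfolding eventually_atin by (metis Diff_iff openin_topspace)

lemma lim_squeeze:
  assumes "\<And>y. y \<in> T \<Longrightarrow> nrm B (h y) \<le> g y" "\<And>y. y \<in> T \<Longrightarrow> h y \<in> carrier B" "(g \<longlongrightarrow> 0) (atin X x)"
  shows "((\<lambda>y. nrm B (h y)) \<longlongrightarrow> 0) (atin X x)"
  by (rule tendsto_sandwich[OF _ _ tendsto_const assms(3)];
      rule eventually_mono[OF ev_top]) (use assms nrm_nonneg in auto)

lemma P_I:
  assumes "F \<in> extensional T" "\<And>x. x \<in> T \<Longrightarrow> F x \<in> carrier B"
    "\<And>x. x \<in> T \<Longrightarrow> ((\<lambda>y. nrm B (F y \<ominus> F x)) \<longlongrightarrow> 0) (atin X x)"
  shows "F \<in> carrier P"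
  using assms by (auto simp: cont_alg_def PiE_iff)

lemma P_restrictI:
  assumes "\<And>x. x \<in> T \<Longrightarrow> F x \<in> carrier B"
    "\<And>x. x \<in> T \<Longrightarrow> ((\<lambda>y. nrm B (F y \<ominus> F x)) \<longlongrightarrow> 0) (atin X x)"
  shows "(\<lambda>x\<in>T. F x) \<in> carrier P"
proof (rule P_I)
  fix x assume x: "x \<in> T"
  show "((\<lambda>y. nrm B ((\<lambda>x\<in>T. F x) y \<ominus> (\<lambda>x\<in>T. F x) x)) \<longlongrightarrow> 0) (atin X x)"
    by (rule Lim_transform_eventually[OF assms(2)[OF x]], rule eventually_mono[OF ev_top]) (use x in auto)
qed (use assms in auto)

lemma P_add: assumes F: "F \<in> carrier P" and G: "G \<in> carrier P" shows "(\<lambda>x\<in>T. F x \<oplus> G x) \<in> carrier P"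
proof (rule P_restrictI)
  fix x assume x: "x \<in> T"
  show "((\<lambda>y. nrm B (F y \<oplus> G y \<ominus> (F x \<oplus> G x))) \<longlongrightarrow> 0) (atin X x)"
    by (rule lim_squeeze[OF _ _ tendsto_add_zero[OF P_carrier_lim[OF F x] P_carrier_lim[OF G x]]])
      (use x F G in \<open>auto simp: P_carrier_val add_diff intro: nrm_triangle\<close>)
qed (use F G in \<open>auto simp: P_carrier_val\<close>)

lemma P_smult: assumes F: "F \<in> carrier P" shows "(\<lambda>x\<in>T. c \<odot> F x) \<in> carrier P"
proof (rule P_restrictI)
  fix x assume x: "x \<in> T"
  show "((\<lambda>y. nrm B (c \<odot> F y \<ominus> c \<odot> F x)) \<longlongrightarrow> 0) (atin X x)"
    by (rule lim_squeeze[OF _ _ tendsto_mult_right_zero[OF P_carrier_lim[OF F x], of "cmod c"]])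
      (use x F in \<open>auto simp: P_carrier_val smult_closed smult_diff[symmetric] nrm_smult\<close>)
qed (use F in \<open>auto simp: P_carrier_val smult_closed\<close>)

lemma P_adj: assumes F: "F \<in> carrier P" shows "(\<lambda>x\<in>T. adj B (F x)) \<in> carrier P"
proof (rule P_restrictI)
  fix x assume x: "x \<in> T"
  show "((\<lambda>y. nrm B (adj B (F y) \<ominus> adj B (F x))) \<longlongrightarrow> 0) (atin X x)"
    by (rule lim_squeeze[OF _ _ P_carrier_lim[OF F x]])
      (use x F in \<open>auto simp: P_carrier_val adj_closed adj_diff[symmetric] nrm_adj\<close>)
qed (use F in \<open>auto simp: P_carrier_val adj_closed\<close>)

lemma P_const: assumes "b \<in> carrier B" shows "(\<lambda>x\<in>T. b) \<in> carrier P"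
  proof -
  have "nrm B (b \<ominus> b) = 0" using assms nrm_zero by (simp add: a_minus_def r_neg)
  then show ?thesis using assms by (intro P_restrictI) (auto simp del: minus_eq_zero_iff)
qed

lemma P_mult: assumes F: "F \<in> carrier P" and G: "G \<in> carrier P" shows "(\<lambda>x\<in>T. F x \<otimes> G x) \<in> carrier P"
proof (rule P_restrictI)
  fix x assume x: "x \<in> T"
  let ?f = "\<lambda>y. nrm B (F y \<ominus> F x)" and ?g = "\<lambda>y. nrm B (G y \<ominus> G x)"
  have lim: "((\<lambda>y. ?f y * (?g y + nrm B (G x)) + nrm B (F x) * ?g y) \<longlongrightarrow> 0) (atin X x)"
    by (rule tendsto_eq_intros P_carrier_lim[OF F x] P_carrier_lim[OF G x] refl | simp)+
  show "((\<lambda>y. nrm B (F y \<otimes> G y \<ominus> F x \<otimes> G x)) \<longlongrightarrow> 0) (atin X x)"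
  proof (rule lim_squeeze[OF _ _ lim])
    fix y assume y: "y \<in> T"
    note c = P_carrier_val[OF F x] P_carrier_val[OF F y] P_carrier_val[OF G x] P_carrier_val[OF G y]
    have "nrm B (F y \<otimes> G y \<ominus> F x \<otimes> G x) \<le> nrm B ((F y \<ominus> F x) \<otimes> G y) + nrm B (F x \<otimes> (G y \<ominus> G x))"
      using c by (simp add: mult_diff nrm_triangle)
    also have "\<dots> \<le> ?f y * nrm B (G y) + nrm B (F x) * ?g y"
      using c by (intro add_mono nrm_mult) auto
    also have "\<dots> \<le> ?f y * (?g y + nrm B (G x)) + nrm B (F x) * ?g y"
      using c by (intro add_mono mult_left_mono nrm_le_diff nrm_nonneg) auto
    finally show "nrm B (F y \<otimes> G y \<ominus> F x \<otimes> G x) \<le> \<dots>" .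
  qed (use x F G in \<open>auto simp: P_carrier_val\<close>)
qed (use F G in \<open>auto simp: P_carrier_val\<close>)

lemma P_simps:
  "F \<oplus>\<^bsub>P\<^esub> G = (\<lambda>x\<in>T. F x \<oplus> G x)" "F \<otimes>\<^bsub>P\<^esub> G = (\<lambda>x\<in>T. F x \<otimes> G x)"
  "c \<odot>\<^bsub>P\<^esub> F = (\<lambda>x\<in>T. c \<odot> F x)" "adj P F = (\<lambda>x\<in>T. adj B (F x))"
  "\<zero>\<^bsub>P\<^esub> = (\<lambda>x\<in>T. \<zero>)" "\<one>\<^bsub>P\<^esub> = (\<lambda>x\<in>T. \<one>)"
  "nrm P F = Sup (insert 0 ((\<lambda>x. nrm B (F x)) ` T))"
  by (auto simp: cont_alg_def)

lemma P_neg: assumes F: "F \<in> carrier P" shows "(\<lambda>x\<in>T. \<ominus> F x) \<in> carrier P"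
proof -
  have "(\<lambda>x\<in>T. \<ominus> F x) = (\<lambda>x\<in>T. (-1) \<odot> F x)"
    using F by (auto simp: smult_minus P_carrier_val)
  then show ?thesis using P_smult[OF F] by simp
qed

lemma P_closed:
  "\<lbrakk>F \<in> carrier P; G \<in> carrier P\<rbrakk> \<Longrightarrow> F \<oplus>\<^bsub>P\<^esub> G \<in> carrier P"
  "\<lbrakk>F \<in> carrier P; G \<in> carrier P\<rbrakk> \<Longrightarrow> F \<otimes>\<^bsub>P\<^esub> G \<in> carrier P"
  "F \<in> carrier P \<Longrightarrow> c \<odot>\<^bsub>P\<^esub> F \<in> carrier P" "F \<in> carrier P \<Longrightarrow> adj P F \<in> carrier P"
  "\<zero>\<^bsub>P\<^esub> \<in> carrier P" "\<one>\<^bsub>P\<^esub> \<in> carrier P"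
  unfolding P_simps by (intro P_add P_mult P_smult P_adj P_const zero_closed one_closed; assumption)+

lemma P_val:
  assumes "x \<in> T"
  shows "(F \<oplus>\<^bsub>P\<^esub> G) x = F x \<oplus> G x" "(F \<otimes>\<^bsub>P\<^esub> G) x = F x \<otimes> G x"
    "(c \<odot>\<^bsub>P\<^esub> F) x = c \<odot> F x" "adj P F x = adj B (F x)" "\<zero>\<^bsub>P\<^esub> x = \<zero>" "\<one>\<^bsub>P\<^esub> x = \<one>"
  using assms by (auto simp: P_simps)

lemma P_ring: "ring P"
proof (rule ringI)
  show "abelian_group P"
  proof (rule abelian_groupI)
    fix F assume F: "F \<in> carrier P"
    show "\<exists>G\<in>carrier P. G \<oplus>\<^bsub>P\<^esub> F = \<zero>\<^bsub>P\<^esub>"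
      by (rule bexI[OF _ P_neg[OF F]], rule P_ext)
        (use F P_neg in \<open>auto simp: P_val P_carrier_val l_neg intro!: P_closed\<close>)
  qed (auto intro!: P_closed P_ext a_comm simp: P_val P_carrier_val a_assoc)
  show "monoid P"
    by (rule monoidI) (auto intro!: P_closed P_ext simp: P_val P_carrier_val m_assoc)
qed (auto intro!: P_closed P_ext simp: P_val P_carrier_val l_distr r_distr)

lemma P_bdd: assumes F: "F \<in> carrier P" shows "bdd_above (insert 0 ((\<lambda>x. nrm B (F x)) ` T))"
proof -
  have "continuous_map X euclideanreal (\<lambda>x. nrm B (F x))"
    unfolding continuous_map_atin
  proof
    fix x assume x: "x \<in> T"
    have "((\<lambda>y. nrm B (F y) - nrm B (F x)) \<longlongrightarrow> 0) (atin X x)"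
    proof (rule Lim_null_comparison[OF _ P_carrier_lim[OF F x]], rule eventually_mono[OF ev_top])
      fix y assume y: "y \<in> T"
      show "norm (nrm B (F y) - nrm B (F x)) \<le> nrm B (F y \<ominus> F x)"
        using nrm_le_diff[of "F x" "F y"] nrm_le_diff[of "F y" "F x"] nrm_diff_commute[of "F x" "F y"]
          P_carrier_val[OF F x] P_carrier_val[OF F y] by auto
    qed
    then show "limitin euclideanreal (\<lambda>x. nrm B (F x)) (nrm B (F x)) (atin X x)"
      using LIM_zero_cancel by auto
  qed
  then have "compactin euclideanreal ((\<lambda>x. nrm B (F x)) ` T)"
    using cpt image_compactin unfolding compact_space_def by blast
  then show ?thesis by (simp add: compact_imp_bounded bounded_imp_bdd_above)
qed

lemma P_nrm_ge: "F \<in> carrier P \<Longrightarrow> x \<in> T \<Longrightarrow> nrm B (F x) \<le> nrm P F"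
  unfolding P_simps using P_bdd by (intro cSup_upper) auto

lemma P_nrm_nonneg: "F \<in> carrier P \<Longrightarrow> 0 \<le> nrm P F"
  unfolding P_simps using P_bdd by (intro cSup_upper) auto

lemma P_nrm_le: "\<lbrakk>0 \<le> r; \<And>x. x \<in> T \<Longrightarrow> nrm B (F x) \<le> r\<rbrakk> \<Longrightarrow> nrm P F \<le> r"
  unfolding P_simps by (intro cSup_least) auto

lemma P_minus: 
  assumes F: "F \<in> carrier P" and G: "G \<in> carrier P" shows "F \<ominus>\<^bsub>P\<^esub> G = (\<lambda>x\<in>T. F x \<ominus> G x)"
proof -
  interpret P: ring P by (rule P_ring)
  have "\<ominus>\<^bsub>P\<^esub> G = (\<lambda>x\<in>T. \<ominus> G x)"
    by (rule P.minus_equality[OF _ G P_neg[OF G]])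
     (auto simp: P_simps(1,5) P_carrier_val[OF G] l_neg intro!: restrict_ext)
  then show ?thesis unfolding a_minus_def P_simps(1) by (auto intro!: restrict_ext)
qed

lemma P_complete:
  assumes s: "\<And>k::nat. s k \<in> carrier P" 
    and C: "\<And>e. e > 0 \<Longrightarrow> \<exists>N. \<forall>k\<ge>N. \<forall>l\<ge>N. nrm P (s k \<ominus>\<^bsub>P\<^esub> s l) < e"
  shows "\<exists>F\<in>carrier P. (\<lambda>k. nrm P (s k \<ominus>\<^bsub>P\<^esub> F)) \<longlonglongrightarrow> 0"
proof -
  interpret P: ring P by (rule P_ring)
  have le: "nrm B (s k x \<ominus> s l x) \<le> nrm P (s k \<ominus>\<^bsub>P\<^esub> s l)" if "x \<in> T" for k l x
    using P_nrm_ge[OF P.minus_closed[OF s s] that, of k l] P_minus[OF s s, of k l] that by simp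
  have "\<exists>b\<in>carrier B. (\<lambda>k. nrm B (s k x \<ominus> b)) \<longlonglongrightarrow> 0" if x: "x \<in> T" for x
    by (rule complete) (use P_carrier_val[OF s x] C le[OF x] in \<open>auto, meson le_less_trans\<close>)
  then obtain f where f: "\<And>x. x \<in> T \<Longrightarrow> f x \<in> carrier B" 
     "\<And>x. x \<in> T \<Longrightarrow> (\<lambda>k. nrm B (s k x \<ominus> f x)) \<longlonglongrightarrow> 0" by metis
  have unif: "\<exists>N. \<forall>k\<ge>N. \<forall>x\<in>T. nrm B (s k x \<ominus> f x) \<le> e" if e: "e > 0" for e
  proof -
    obtain N where N: "\<And>k l. k \<ge> N \<Longrightarrow> l \<ge> N \<Longrightarrow> nrm P (s k \<ominus>\<^bsub>P\<^esub> s l) < e" using C[OF e] by blast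
    have "nrm B (s k x \<ominus> f x) \<le> e" if k: "k \<ge> N" and x: "x \<in> T" for k x
    proof -
      have "\<forall>\<^sub>F l in sequentially. nrm B (s k x \<ominus> f x) \<le> e + nrm B (s l x \<ominus> f x)"
      proof (rule eventually_sequentiallyI)
        fix l assume "l \<ge> N"
        then have "nrm B (s k x \<ominus> s l x) \<le> e" using le[OF x, of k l] N[OF k, of l] by simp
        then show "nrm B (s k x \<ominus> f x) \<le> e + nrm B (s l x \<ominus> f x)"
          using nrm_diff_triangle[OF P_carrier_val[OF s x] P_carrier_val[OF s x] f(1)[OF x], of k l] by simp
      qed
      moreover have "(\<lambda>l. e + nrm B (s l x \<ominus> f x)) \<longlonglongrightarrow> e + 0"
        by (intro tendsto_intros f(2) x)
      ultimately show ?thesis using tendsto_lowerbound by fastforce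
    qed
    then show ?thesis by blast
  qed
  define F where "F = (\<lambda>x\<in>T. f x)"
  have F: "F \<in> carrier P" unfolding F_def
  proof (rule P_restrictI[OF f(1)])
    fix x assume x: "x \<in> T"
    show "((\<lambda>y. nrm B (f y \<ominus> f x)) \<longlongrightarrow> 0) (atin X x)"
    proof (rule tendstoI)
      fix e :: real assume e: "e > 0"
      then obtain N where N: "\<forall>x\<in>T. nrm B (s N x \<ominus> f x) \<le> e / 3" using unif[of "e/3"] by auto
      have "\<forall>\<^sub>F y in atin X x. dist (nrm B (s N y \<ominus> s N x)) 0 < e / 3"
        using P_carrier_lim[OF s x, of N] e by (intro tendstoD) auto
      then show "\<forall>\<^sub>F y in atin X x. dist (nrm B (f y \<ominus> f x)) 0 < e"
        using ev_top
      proof eventually_elim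
        case (elim y)
        note c = f(1)[OF x] f(1)[OF elim(2)] P_carrier_val[OF s x, of N] P_carrier_val[OF s elim(2), of N]
        have "nrm B (f y \<ominus> f x) \<le> nrm B (f y \<ominus> s N y) + (nrm B (s N y \<ominus> s N x) + nrm B (s N x \<ominus> f x))"
          using nrm_diff_triangle[of "f y" "s N y" "f x"] nrm_diff_triangle[of "s N y" "s N x" "f x"] c by simp
        moreover have "nrm B (f y \<ominus> s N y) \<le> e / 3" using N elim(2) c nrm_diff_commute[of "f y" "s N y"] by simp
        moreover have "nrm B (s N x \<ominus> f x) \<le> e / 3" using N x by simp
        ultimately show ?case using elim(1) nrm_nonneg[of "f y \<ominus> f x"] c by simp
      qed
    qed
  qed
  have "(\<lambda>k. nrm P (s k \<ominus>\<^bsub>P\<^esub> F)) \<longlonglongrightarrow> 0"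
  proof (rule LIMSEQ_I)
    fix e :: real assume e: "e > 0"
    obtain N where N: "\<forall>k\<ge>N. \<forall>x\<in>T. nrm B (s k x \<ominus> f x) \<le> e / 2" using unif[of "e/2"] e by auto
    have "norm (nrm P (s k \<ominus>\<^bsub>P\<^esub> F) - 0) < e" if "k \<ge> N" for k
    proof -
      have "nrm P (s k \<ominus>\<^bsub>P\<^esub> F) \<le> e / 2"
        by (rule P_nrm_le) (use e N that in \<open>auto simp: P_minus[OF s F] F_def[symmetric], auto simp: F_def\<close>)
      then show ?thesis using e P_nrm_nonneg[OF P.minus_closed[OF s F], of k] by simp
    qed
    then show "\<exists>N. \<forall>k\<ge>N. norm (nrm P (s k \<ominus>\<^bsub>P\<^esub> F) - 0) < e" by blast
  qed
  with F show ?thesis by blast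
qed

lemma P_cstar: "cstar_algebra P"
proof (intro cstar_algebra.intro cstar_algebra_axioms.intro)
  show "ring P" by (rule P_ring)
next
  fix F assume F: "F \<in> carrier P"
  have "F = \<zero>\<^bsub>P\<^esub>" if "nrm P F = 0"
  proof (rule P_ext[OF F])
    show "\<zero>\<^bsub>P\<^esub> \<in> carrier P" by (simp add: P_simps P_const)
    fix x assume x: "x \<in> T"
    have "nrm B (F x) = 0" using P_nrm_ge[OF F x] nrm_nonneg[OF P_carrier_val[OF F x]] that by simp
    then show "F x = \<zero>\<^bsub>P\<^esub> x" using nrm_eq_0[OF P_carrier_val[OF F x]] x by (simp add: P_simps)
  qed
  moreover have "nrm P \<zero>\<^bsub>P\<^esub> = 0"
  proof -
    have "\<zero>\<^bsub>P\<^esub> \<in> carrier P" by (simp add: P_simps P_const)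
    moreover have "nrm P \<zero>\<^bsub>P\<^esub> \<le> 0" by (rule P_nrm_le) (auto simp: P_simps nrm_zero)
    ultimately show ?thesis using P_nrm_nonneg by fastforce
  qed
  ultimately show "(nrm P F = 0) = (F = \<zero>\<^bsub>P\<^esub>)" by blast
next
  fix F G assume F: "F \<in> carrier P" and G: "G \<in> carrier P"
  show "nrm P (F \<oplus>\<^bsub>P\<^esub> G) \<le> nrm P F + nrm P G"
  proof (rule P_nrm_le)
    fix x assume x: "x \<in> T"
    show "nrm B ((F \<oplus>\<^bsub>P\<^esub> G) x) \<le> nrm P F + nrm P G"
      using nrm_triangle[OF P_carrier_val[OF F x] P_carrier_val[OF G x]] P_nrm_ge[OF F x] P_nrm_ge[OF G x] x
      by (simp add: P_simps(1))
  qed (use P_nrm_nonneg F G in simp)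
  show "nrm P (F \<otimes>\<^bsub>P\<^esub> G) \<le> nrm P F * nrm P G"
  proof (rule P_nrm_le)
    fix x assume x: "x \<in> T"
    have "nrm B (F x \<otimes> G x) \<le> nrm B (F x) * nrm B (G x)" by (intro nrm_mult P_carrier_val F G x)
    also have "\<dots> \<le> nrm P F * nrm P G"
      by (intro mult_mono P_nrm_ge P_nrm_nonneg nrm_nonneg P_carrier_val F G x)
    finally show "nrm B ((F \<otimes>\<^bsub>P\<^esub> G) x) \<le> nrm P F * nrm P G" using x by (simp add: P_simps(2))
  qed (use P_nrm_nonneg F G in simp)
next
  fix F c assume F: "F \<in> carrier P"
  have le: "nrm P (c \<odot>\<^bsub>P\<^esub> F) \<le> cmod c * nrm P F" if F: "F \<in> carrier P" for c F
    by (rule P_nrm_le) (use F P_nrm_nonneg[OF F] P_nrm_ge[OF F] in 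
       \<open>auto simp: P_simps(3) nrm_smult P_carrier_val intro!: mult_left_mono\<close>)
  show "nrm P (c \<odot>\<^bsub>P\<^esub> F) = cmod c * nrm P F"
  proof (cases "c = 0")
    case True
    have cF: "c \<odot>\<^bsub>P\<^esub> F \<in> carrier P" using P_smult[OF F] by (simp add: P_simps(3))
    then show ?thesis using le[OF F, of c] P_nrm_nonneg[OF cF] True by simp
  next
    case False
    have cF: "c \<odot>\<^bsub>P\<^esub> F \<in> carrier P" using P_smult[OF F] by (simp add: P_simps(3))
    have "inverse c \<odot>\<^bsub>P\<^esub> (c \<odot>\<^bsub>P\<^esub> F) = F"
      by (rule P_ext[OF _ F]) (use F False in \<open>auto simp: P_val P_closed smult_assoc[symmetric] P_carrier_val smult_one\<close>)
    then have "nrm P F \<le> cmod (inverse c) * nrm P (c \<odot>\<^bsub>P\<^esub> F)" using le[OF cF, of "inverse c"] by simp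
    then have "cmod c * nrm P F \<le> nrm P (c \<odot>\<^bsub>P\<^esub> F)" using False
      by (simp add: norm_inverse norm_divide field_simps)
    then show ?thesis using le[OF F, of c] by simp
  qed
next
  fix F assume F: "F \<in> carrier P"
  have aF: "adj P F \<in> carrier P" using P_adj[OF F] by (simp add: P_simps(4))
  have aFF: "adj P F \<otimes>\<^bsub>P\<^esub> F \<in> carrier P" using P_mult[OF aF F] by (simp add: P_simps(2))
  have val: "nrm B ((adj P F \<otimes>\<^bsub>P\<^esub> F) x) = (nrm B (F x))\<^sup>2" if "x \<in> T" for x
    using that nrm_adj_mult[OF P_carrier_val[OF F that]] by (simp add: P_simps(2,4))
  have "nrm P F \<le> sqrt (nrm P (adj P F \<otimes>\<^bsub>P\<^esub> F))"
    by (rule P_nrm_le) (use P_nrm_nonneg[OF aFF] P_nrm_ge[OF aFF] val real_le_rsqrt in auto)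
  then have "(nrm P F)\<^sup>2 \<le> nrm P (adj P F \<otimes>\<^bsub>P\<^esub> F)"
    using P_nrm_nonneg[OF F] P_nrm_nonneg[OF aFF] by (metis power_mono real_sqrt_pow2)
  moreover have "nrm P (adj P F \<otimes>\<^bsub>P\<^esub> F) \<le> (nrm P F)\<^sup>2"
    by (rule P_nrm_le) (use val P_nrm_ge[OF F] nrm_nonneg P_carrier_val[OF F] in \<open>auto intro!: power_mono\<close>)
  ultimately show "nrm P (adj P F \<otimes>\<^bsub>P\<^esub> F) = (nrm P F)\<^sup>2" by simp
next
  fix s :: "nat \<Rightarrow> 'a \<Rightarrow> 'b"
  assume "\<And>k. s k \<in> carrier P" "\<And>e. e > 0 \<Longrightarrow> \<exists>N. \<forall>k\<ge>N. \<forall>l\<ge>N. nrm P (s k \<ominus>\<^bsub>P\<^esub> s l) < e"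
  then show "\<exists>x\<in>carrier P. (\<lambda>k. nrm P (s k \<ominus>\<^bsub>P\<^esub> x)) \<longlonglongrightarrow> 0"
    by (rule P_complete)
qed (auto simp: P_val P_nrm_nonneg P_carrier_val smult_closed smult_l_distr smult_r_distr smult_assoc smult_one
      smult_mult_l smult_mult_r adj_closed adj_adj adj_add adj_smult adj_mult
      intro!: P_closed P_ext)

lemma P_finsum:
  assumes "\<And>i. i < (k::nat) \<Longrightarrow> F i \<in> carrier P" "x \<in> T"
  shows "(\<Oplus>\<^bsub>P\<^esub>i\<in>{..<k}. F i) x = (\<Oplus>i\<in>{..<k}. F i x)"
proof -
  interpret P: ring P by (rule P_ring)
  show ?thesis using assms
  proof (induction k)
    case 0 then show ?case by (simp add: P_simps)
  next
    case (Suc k)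
    then show ?case
      by (subst lessThan_Suc, subst lessThan_Suc, subst P.finsum_insert)
        (auto simp: P_simps(1) finsum_insert P_carrier_val Pi_iff)
  qed
qed

end


definition complex_alg :: "complex cstar" where
  "complex_alg = \<lparr>carrier = UNIV, mult = (*), one = 1, zero = 0, add = (+), smult = (*),
     adj = cnj, nrm = cmod\<rparr>"

lemma complex_ring: "ring complex_alg"
  by unfold_locales (auto simp: complex_alg_def algebra_simps Units_def intro: exI[of _ "- _"])

lemma complex_minus: "x \<ominus>\<^bsub>complex_alg\<^esub> y = x - y"
proof -
  interpret ring complex_alg by (rule complex_ring)
  have "\<ominus>\<^bsub>complex_alg\<^esub> y = - y" by (rule minus_equality) (auto simp: complex_alg_def)
  then show ?thesis unfolding a_minus_def by (simp add: complex_alg_def)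
qed

lemma complex_cstar: "cstar_algebra complex_alg"
proof (intro cstar_algebra.intro cstar_algebra_axioms.intro complex_ring)
  fix s :: "nat \<Rightarrow> complex"
  assume "\<And>e. e > 0 \<Longrightarrow> \<exists>N. \<forall>k\<ge>N. \<forall>l\<ge>N. nrm complex_alg (s k \<ominus>\<^bsub>complex_alg\<^esub> s l) < e"
  then have "Cauchy s" unfolding complex_minus by (intro CauchyI) (simp add: complex_alg_def)
  then obtain l where "s \<longlonglongrightarrow> l" using Cauchy_convergent_iff convergent_def by blast
  then show "\<exists>x\<in>carrier complex_alg. (\<lambda>k. nrm complex_alg (s k \<ominus>\<^bsub>complex_alg\<^esub> x)) \<longlonglongrightarrow> 0"
    unfolding complex_minus by (auto simp: complex_alg_def tendsto_norm_zero_iff LIM_zero_iff)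
next
  fix x show "nrm complex_alg (adj complex_alg x \<otimes>\<^bsub>complex_alg\<^esub> x) = (nrm complex_alg x)\<^sup>2"
    by (simp add: complex_alg_def norm_mult power2_eq_square)
qed (auto simp: complex_alg_def algebra_simps norm_mult intro: norm_triangle_ineq)

lemma C_alg_eq: "C_alg X = cont_alg X complex_alg"
proof -
  have "a \<in> extensional (topspace X) \<and> continuous_map X euclidean a \<longleftrightarrow>
     a \<in> topspace X \<rightarrow>\<^sub>E UNIV \<and> (\<forall>x\<in>topspace X. ((\<lambda>y. cmod (a y - a x)) \<longlongrightarrow> 0) (atin X x))"
    for a :: "'a \<Rightarrow> complex"
    by (auto simp: continuous_map_atin PiE_iff tendsto_norm_zero_iff LIM_zero_iff)
  then show ?thesis
    unfolding C_alg_def cont_alg_def complex_minus by (simp add: complex_alg_def)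
qed

lemma C_alg_cstar: "compact_space X \<Longrightarrow> cstar_algebra (C_alg X)"
  unfolding C_alg_eq by (intro cont_alg_loc.P_cstar cont_alg_loc.intro complex_cstar cont_alg_loc_axioms.intro)

lemma cvec_norm_L2: "cvec_norm v = L2_set (\<lambda>i. cmod (vec_index v i)) {..<dim_vec v}"
proof -
  have "Re (v \<bullet>c v) = (\<Sum>i<dim_vec v. (cmod (vec_index v i))\<^sup>2)"
    by (auto simp: scalar_prod_def complex_norm_square[symmetric] lessThan_atLeast0 Re_sum simp flip: of_real_power intro!: sum.cong)
  then show ?thesis by (simp add: cvec_norm_def L2_set_def)
qed

lemma cvec_norm_sq: "complex_of_real ((cvec_norm v)\<^sup>2) = v \<bullet>c v"
proof -
  have "v \<bullet>c v = of_real (\<Sum>i<dim_vec v. (cmod (vec_index v i))\<^sup>2)"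
    by (auto simp: scalar_prod_def complex_norm_square[symmetric] lessThan_atLeast0 simp flip: of_real_power intro!: sum.cong)
  then show ?thesis by (simp add: cvec_norm_L2 L2_set_def sum_nonneg)
qed

lemma cvec_norm_nonneg: "0 \<le> cvec_norm v"
  by (simp add: cvec_norm_L2)

lemma cvec_norm_smult: "cvec_norm (c \<cdot>\<^sub>v v) = cmod c * cvec_norm v"
  by (auto simp: cvec_norm_L2 L2_set_right_distrib norm_mult intro!: L2_set_cong)

lemma cvec_norm_add:
  assumes "v \<in> carrier_vec n" "w \<in> carrier_vec n"
  shows "cvec_norm (v + w) \<le> cvec_norm v + cvec_norm w"
proof -
  have "cvec_norm (v + w) \<le> L2_set (\<lambda>i. cmod (vec_index v i) + cmod (vec_index w i)) {..<n}"
    using assms by (auto simp: cvec_norm_L2 intro!: L2_set_mono norm_triangle_ineq)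
  also have "\<dots> \<le> cvec_norm v + cvec_norm w"
    using assms by (auto simp: cvec_norm_L2 intro!: L2_set_triangle_ineq)
  finally show ?thesis .
qed

lemma cvec_CS:
  assumes "v \<in> carrier_vec n" "w \<in> carrier_vec n"
  shows "cmod (v \<bullet>c w) \<le> cvec_norm v * cvec_norm w"
proof -
  have "cmod (v \<bullet>c w) \<le> (\<Sum>i<n. \<bar>cmod (vec_index v i)\<bar> * \<bar>cmod (vec_index w i)\<bar>)"
    using assms by (auto simp: scalar_prod_def lessThan_atLeast0 norm_mult intro!: sum_norm_le)
  also have "\<dots> \<le> cvec_norm v * cvec_norm w"
    using assms L2_set_mult_ineq[of "\<lambda>i. cmod (vec_index v i)" "\<lambda>i. cmod (vec_index w i)" "{..<n}"] by (simp add: cvec_norm_L2)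
  finally show ?thesis .
qed

lemma cvec_entry: "i < dim_vec v \<Longrightarrow> cmod (vec_index v i) \<le> cvec_norm v"
  unfolding cvec_norm_L2 by (intro member_le_L2_set) auto

lemma adjoint_dim: "A \<in> carrier_mat n n \<Longrightarrow> mat_adjoint A \<in> carrier_mat n n"
  by (auto simp: mat_adjoint_def)

lemma adjoint_index: "A \<in> carrier_mat n n \<Longrightarrow> i < n \<Longrightarrow> j < n \<Longrightarrow> mat_adjoint A $$ (i,j) = cnj (A $$ (j,i))"
  by (auto simp: mat_adjoint_def mat_of_rows_def)

lemma adjoint_prod:
  fixes A :: "complex mat"
  assumes A: "A \<in> carrier_mat n n" and v: "v \<in> carrier_vec n" and w: "w \<in> carrier_vec n"
  shows "(A *\<^sub>v v) \<bullet>c w = v \<bullet>c (mat_adjoint A *\<^sub>v w)"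
proof -
  note aA = adjoint_dim[OF A]
  have Av: "vec_index (A *\<^sub>v v) i = (\<Sum>j<n. A $$ (i,j) * vec_index v j)" if "i < n" for i
    using A v that by (simp add: scalar_prod_def lessThan_atLeast0)
  have aw: "vec_index (mat_adjoint A *\<^sub>v w) j = (\<Sum>i<n. cnj (A $$ (i,j)) * vec_index w i)" if "j < n" for j
    using aA w that by (simp add: scalar_prod_def lessThan_atLeast0 adjoint_index[OF A])
  have "(A *\<^sub>v v) \<bullet>c w = (\<Sum>i<n. vec_index (A *\<^sub>v v) i * cnj (vec_index w i))"
    using A w by (simp add: scalar_prod_def lessThan_atLeast0)
  also have "\<dots> = (\<Sum>i<n. \<Sum>j<n. A $$ (i,j) * vec_index v j * cnj (vec_index w i))"
    by (intro sum.cong refl) (simp add: Av sum_distrib_right)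
  also have "\<dots> = (\<Sum>j<n. \<Sum>i<n. A $$ (i,j) * vec_index v j * cnj (vec_index w i))" by (rule sum.swap)
  also have "\<dots> = (\<Sum>j<n. vec_index v j * cnj (vec_index (mat_adjoint A *\<^sub>v w) j))"
    by (intro sum.cong refl) (simp add: aw sum_distrib_left mult_ac)
  also have "\<dots> = v \<bullet>c (mat_adjoint A *\<^sub>v w)"
    using aA w by (simp add: scalar_prod_def lessThan_atLeast0)
  finally show ?thesis .
qed

abbreviation opn :: "nat \<Rightarrow> complex mat \<Rightarrow> real" where "opn n \<equiv> nrm (L_alg n)"

lemma mat_vec_bound:
  assumes S: "S \<in> carrier_mat n n" and v: "v \<in> carrier_vec n"
  shows "cvec_norm (S *\<^sub>v v) \<le> (\<Sum>i<n. \<Sum>j<n. cmod (S $$ (i,j))) * cvec_norm v"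
proof -
  have "cvec_norm (S *\<^sub>v v) \<le> (\<Sum>i<n. cmod (vec_index (S *\<^sub>v v) i))"
    using S L2_set_le_sum[of "{..<n}" "\<lambda>i. cmod (vec_index (S *\<^sub>v v) i)"] by (auto simp: cvec_norm_L2)
  also have "\<dots> \<le> (\<Sum>i<n. (\<Sum>j<n. cmod (S $$ (i,j))) * cvec_norm v)"
  proof (rule sum_mono)
    fix i assume i: "i \<in> {..<n}"
    have "cmod (vec_index (S *\<^sub>v v) i) \<le> (\<Sum>j<n. cmod (S $$ (i,j)) * cmod (vec_index v j))"
      using S v i by (auto simp: scalar_prod_def lessThan_atLeast0 norm_mult intro!: sum_norm_le)
    also have "\<dots> \<le> (\<Sum>j<n. cmod (S $$ (i,j)) * cvec_norm v)"
      using v by (intro sum_mono mult_left_mono cvec_entry) auto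
    finally show "cmod (vec_index (S *\<^sub>v v) i) \<le> (\<Sum>j<n. cmod (S $$ (i,j))) * cvec_norm v"
      by (simp add: sum_distrib_right)
  qed
  finally show ?thesis by (simp add: sum_distrib_right)
qed

lemma opn_def: "opn n S = (SUP v\<in>{v \<in> carrier_vec n. cvec_norm v \<le> 1}. cvec_norm (S *\<^sub>v v))"
  by (simp add: L_alg_def)

lemma cvec_norm_zero: "cvec_norm (0\<^sub>v n) = 0"
  by (simp add: cvec_norm_L2 L2_set_def)

lemma opn_le:
  assumes "\<And>v. v \<in> carrier_vec n \<Longrightarrow> cvec_norm v \<le> 1 \<Longrightarrow> cvec_norm (S *\<^sub>v v) \<le> r"
  shows "opn n S \<le> r"
proof -
  have "{v \<in> carrier_vec n. cvec_norm v \<le> 1} \<noteq> {}" using cvec_norm_zero[of n] by (auto intro!: exI[of _ "0\<^sub>v n"])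
  then show ?thesis unfolding opn_def using assms by (intro cSUP_least) auto
qed

lemma opn_bdd: 
  assumes "S \<in> carrier_mat n n"
  shows "bdd_above ((\<lambda>v. cvec_norm (S *\<^sub>v v)) ` {v \<in> carrier_vec n. cvec_norm v \<le> 1})"
proof (rule bdd_aboveI2)
  fix v assume "v \<in> {v \<in> carrier_vec n. cvec_norm v \<le> 1}"
  then have v: "v \<in> carrier_vec n" "cvec_norm v \<le> 1" by auto
  show "cvec_norm (S *\<^sub>v v) \<le> (\<Sum>i<n. \<Sum>j<n. cmod (S $$ (i,j)))"
    using mat_vec_bound[OF assms v(1)] mult_left_mono[OF v(2), of "\<Sum>i<n. \<Sum>j<n. cmod (S $$ (i,j))"]
    by (simp add: sum_nonneg)
qed

lemma opn_ge1: "S \<in> carrier_mat n n \<Longrightarrow> v \<in> carrier_vec n \<Longrightarrow> cvec_norm v \<le> 1 \<Longrightarrow> cvec_norm (S *\<^sub>v v) \<le> opn n S"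
  unfolding opn_def using opn_bdd by (intro cSUP_upper) auto

lemma opn_nonneg: "S \<in> carrier_mat n n \<Longrightarrow> 0 \<le> opn n S"
  using opn_ge1[of S n "0\<^sub>v n"] cvec_norm_nonneg[of "S *\<^sub>v 0\<^sub>v n"] by (simp add: cvec_norm_zero)

lemma opn_ge:
  assumes S: "S \<in> carrier_mat n n" and v: "v \<in> carrier_vec n" 
  shows "cvec_norm (S *\<^sub>v v) \<le> opn n S * cvec_norm v"
proof (cases "cvec_norm v = 0")
  case True
  then show ?thesis using mat_vec_bound[OF S v] by simp
next
  case False
  then have p: "cvec_norm v > 0" using cvec_norm_nonneg[of v] by simp
  let ?c = "complex_of_real (inverse (cvec_norm v))"
  have "cvec_norm (S *\<^sub>v (?c \<cdot>\<^sub>v v)) \<le> opn n S"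
    using v p by (intro opn_ge1[OF S]) (auto simp: cvec_norm_smult norm_inverse)
  then have "inverse (cvec_norm v) * cvec_norm (S *\<^sub>v v) \<le> opn n S"
    using S v p by (simp add: mult_mat_vec cvec_norm_smult norm_inverse)
  then show ?thesis using p by (simp add: field_simps)
qed

lemma opn_le_sum: "S \<in> carrier_mat n n \<Longrightarrow> opn n S \<le> (\<Sum>i<n. \<Sum>j<n. cmod (S $$ (i,j)))"
proof (rule opn_le)
  fix v assume S: "S \<in> carrier_mat n n" and v: "v \<in> carrier_vec n" "cvec_norm v \<le> 1"
  show "cvec_norm (S *\<^sub>v v) \<le> (\<Sum>i<n. \<Sum>j<n. cmod (S $$ (i,j)))"
    using mat_vec_bound[OF S v(1)] mult_left_mono[OF v(2), of "\<Sum>i<n. \<Sum>j<n. cmod (S $$ (i,j))"]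
    by (simp add: sum_nonneg)
qed

lemma opn_entry:
  assumes S: "S \<in> carrier_mat n n" and ij: "i < n" "j < n" 
  shows "cmod (S $$ (i,j)) \<le> opn n S"
proof -
  have "cvec_norm (unit_vec n j) = sqrt (\<Sum>i<n. if i = j then 1 else 0)"
  proof -
    have "(\<Sum>i<n. (cmod (vec_index (unit_vec n j) i))\<^sup>2) = (\<Sum>i<n. if i = j then 1 else 0)"
      using ij by (intro sum.cong) auto
    then show ?thesis unfolding cvec_norm_L2 L2_set_def by simp
  qed
  then have 1: "cvec_norm (unit_vec n j) = 1" using ij by simp
  have "vec_index (S *\<^sub>v unit_vec n j) i = S $$ (i,j)" using S ij by simp
  then have "cmod (S $$ (i,j)) \<le> cvec_norm (S *\<^sub>v unit_vec n j)"
    using cvec_entry[of i "S *\<^sub>v unit_vec n j"] S ij by simp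
  also have "\<dots> \<le> opn n S" using opn_ge1[OF S, of "unit_vec n j"] 1 by simp
  finally show ?thesis .
qed

lemma opn_add: 
  assumes A: "A \<in> carrier_mat n n" and B: "B \<in> carrier_mat n n"
  shows "opn n (A + B) \<le> opn n A + opn n B"
proof (rule opn_le)
  fix v assume v: "v \<in> carrier_vec n" "cvec_norm v \<le> 1"
  have "cvec_norm ((A + B) *\<^sub>v v) \<le> cvec_norm (A *\<^sub>v v) + cvec_norm (B *\<^sub>v v)"
    using A B v by (auto simp: add_mult_distrib_mat_vec[of _ n n] intro!: cvec_norm_add[of _ n])
  then show "cvec_norm ((A + B) *\<^sub>v v) \<le> opn n A + opn n B"
    using opn_ge1[OF A v] opn_ge1[OF B v] by simp
qed

lemma opn_mult: 
  assumes A: "A \<in> carrier_mat n n" and B: "B \<in> carrier_mat n n"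
  shows "opn n (A * B) \<le> opn n A * opn n B"
proof (rule opn_le)
  fix v assume v: "v \<in> carrier_vec n" "cvec_norm v \<le> 1"
  have "cvec_norm ((A * B) *\<^sub>v v) = cvec_norm (A *\<^sub>v (B *\<^sub>v v))"
    using assoc_mult_mat_vec[OF A B v(1)] by simp
  also have "\<dots> \<le> opn n A * cvec_norm (B *\<^sub>v v)" using B v by (intro opn_ge A) auto
  also have "\<dots> \<le> opn n A * opn n B" by (intro mult_left_mono opn_ge1 opn_nonneg A B v)
  finally show "cvec_norm ((A * B) *\<^sub>v v) \<le> opn n A * opn n B" .
qed

lemma mat_adj_adj: "A \<in> carrier_mat n n \<Longrightarrow> mat_adjoint (mat_adjoint A) = A" for A :: "complex mat"
  by (rule eq_matI) (use adjoint_dim[of A n] adjoint_dim[of "mat_adjoint A" n] in 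
    \<open>auto simp: adjoint_index[of A n] adjoint_index[of "mat_adjoint A" n]\<close>)

lemma opn_sq_le: 
  assumes A: "A \<in> carrier_mat n n" 
  shows "(opn n A)\<^sup>2 \<le> opn n (mat_adjoint A * A)"
proof -
  note aA = adjoint_dim[OF A]
  have AA: "mat_adjoint A * A \<in> carrier_mat n n" using A aA by simp
  have "opn n A \<le> sqrt (opn n (mat_adjoint A * A))"
  proof (rule opn_le)
    fix v assume v: "v \<in> carrier_vec n" "cvec_norm v \<le> 1"
    have "(cvec_norm (A *\<^sub>v v))\<^sup>2 = cmod ((A *\<^sub>v v) \<bullet>c (A *\<^sub>v v))"
      by (simp add: cvec_norm_sq[symmetric] norm_power)
    also have "(A *\<^sub>v v) \<bullet>c (A *\<^sub>v v) = v \<bullet>c ((mat_adjoint A * A) *\<^sub>v v)"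
      using A aA v by (subst adjoint_prod[OF A]) (auto simp: assoc_mult_mat_vec[OF aA A])
    also have "cmod \<dots> \<le> cvec_norm v * cvec_norm ((mat_adjoint A * A) *\<^sub>v v)"
      using AA v by (intro cvec_CS[of _ n]) auto
    also have "\<dots> \<le> 1 * opn n (mat_adjoint A * A)"
      by (intro mult_mono opn_ge1 v AA cvec_norm_nonneg) simp
    finally show "cvec_norm (A *\<^sub>v v) \<le> sqrt (opn n (mat_adjoint A * A))"
      by (simp add: real_le_rsqrt)
  qed
  then show ?thesis using opn_nonneg[OF A] opn_nonneg[OF AA] by (metis power_mono real_sqrt_pow2)
qed

lemma opn_adj_le:
  assumes A: "A \<in> carrier_mat n n" shows "opn n A \<le> opn n (mat_adjoint A)"
proof (cases "opn n A = 0")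
  case True then show ?thesis using opn_nonneg adjoint_dim[OF A] by simp
next
  case False
  then have p: "opn n A > 0" using opn_nonneg[OF A] by simp
  have "opn n A * opn n A \<le> opn n (mat_adjoint A) * opn n A"
    using opn_sq_le[OF A] opn_mult[OF adjoint_dim[OF A] A] by (simp add: power2_eq_square)
  then show ?thesis using p by simp
qed

lemma opn_adj: "A \<in> carrier_mat n n \<Longrightarrow> opn n (mat_adjoint A) = opn n A"
  using opn_adj_le[of A n] opn_adj_le[of "mat_adjoint A" n] mat_adj_adj[of A n] adjoint_dim[of A n] by simp

lemma L_simps:
  "carrier (L_alg n) = carrier_mat n n" "mult (L_alg n) = (*)" "one (L_alg n) = 1\<^sub>m n"
  "zero (L_alg n) = 0\<^sub>m n n" "add (L_alg n) = (+)" "smult (L_alg n) = (\<cdot>\<^sub>m)" "adj (L_alg n) = mat_adjoint"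
  by (auto simp: L_alg_def)

lemma L_ring: "ring (L_alg n)"
  by (unfold_locales, insert add_inv_exists_mat, auto simp: L_alg_def algebra_simps Units_def)

lemma L_minus: 
  assumes "A \<in> carrier_mat n n" "B \<in> carrier_mat n n" shows "A \<ominus>\<^bsub>L_alg n\<^esub> B = A - B"
proof -
  interpret ring "L_alg n" by (rule L_ring)
  have "\<ominus>\<^bsub>L_alg n\<^esub> B = - B" by (rule minus_equality) (use assms in \<open>auto simp: L_simps\<close>)
  then show ?thesis unfolding a_minus_def using assms by (simp add: L_simps add_uminus_minus_mat)
qed

lemma L_cstar: "cstar_algebra (L_alg n)"
proof (intro cstar_algebra.intro cstar_algebra_axioms.intro L_ring; unfold L_simps)
  fix A :: "complex mat" assume A: "A \<in> carrier_mat n n"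
  show "opn n (mat_adjoint A * A) = (opn n A)\<^sup>2"
    using opn_sq_le[OF A] opn_mult[OF adjoint_dim[OF A] A] opn_adj[OF A] by (simp add: power2_eq_square)
  show "0 \<le> opn n A" by (rule opn_nonneg[OF A])
  show "(opn n A = 0) = (A = 0\<^sub>m n n)"
  proof
    assume "opn n A = 0"
    then show "A = 0\<^sub>m n n" using opn_entry[OF A] A by (intro eq_matI) auto
  next
    assume "A = 0\<^sub>m n n" then show "opn n A = 0"
      using opn_le_sum[OF A] opn_nonneg[OF A] by simp
  qed
  fix c
  have le: "opn n (c \<cdot>\<^sub>m A) \<le> cmod c * opn n A" if A: "A \<in> carrier_mat n n" for A c
  proof (rule opn_le)
    fix v assume v: "v \<in> carrier_vec n" "cvec_norm v \<le> 1"
    have "(c \<cdot>\<^sub>m A) *\<^sub>v v = c \<cdot>\<^sub>v (A *\<^sub>v v)"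
      using A v by (intro eq_vecI) (auto simp: row_smult)
    then show "cvec_norm ((c \<cdot>\<^sub>m A) *\<^sub>v v) \<le> cmod c * opn n A"
      using opn_ge1[OF A v] by (simp add: cvec_norm_smult mult_left_mono)
  qed
  show "opn n (c \<cdot>\<^sub>m A) = cmod c * opn n A"
  proof (cases "c = 0")
    case True
    then show ?thesis using le[OF A, of c] opn_nonneg[of "c \<cdot>\<^sub>m A" n] A by simp
  next
    case False
    have "inverse c \<cdot>\<^sub>m (c \<cdot>\<^sub>m A) = A" using False by (intro eq_matI) auto
    then have "opn n A \<le> cmod (inverse c) * opn n (c \<cdot>\<^sub>m A)" using le[of "c \<cdot>\<^sub>m A" "inverse c"] A by simp
    then have "cmod c * opn n A \<le> opn n (c \<cdot>\<^sub>m A)" using False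
      by (simp add: norm_inverse norm_divide field_simps)
    then show ?thesis using le[OF A, of c] by simp
  qed
next
  fix s :: "nat \<Rightarrow> complex mat"
  assume s: "\<And>k. s k \<in> carrier_mat n n"
    and C: "\<And>e. e > 0 \<Longrightarrow> \<exists>N. \<forall>k\<ge>N. \<forall>l\<ge>N. opn n (s k \<ominus>\<^bsub>L_alg n\<^esub> s l) < e"
  have "\<exists>l. (\<lambda>k. s k $$ (i,j)) \<longlonglongrightarrow> l" if ij: "i < n" "j < n" for i j
  proof -
    have "Cauchy (\<lambda>k. s k $$ (i,j))"
    proof (rule CauchyI)
      fix e :: real assume "e > 0"
      then obtain N where N: "\<And>k l. k \<ge> N \<Longrightarrow> l \<ge> N \<Longrightarrow> opn n (s k - s l) < e" using C L_minus[OF s s] by metis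
      have "norm (s k $$ (i,j) - s l $$ (i,j)) < e" if "k \<ge> N" "l \<ge> N" for k l
        using opn_entry[of "s k - s l" n i j] N[OF that] s[of k] s[of l] ij minus_carrier_mat[OF s[of l], of "s k"] by simp
      then show "\<exists>M. \<forall>m\<ge>M. \<forall>l\<ge>M. norm (s m $$ (i,j) - s l $$ (i,j)) < e" by blast
    qed
    then show ?thesis using Cauchy_convergent_iff convergent_def by blast
  qed
  then obtain g where g: "\<And>i j. i < n \<Longrightarrow> j < n \<Longrightarrow> (\<lambda>k. s k $$ (i,j)) \<longlonglongrightarrow> g i j" by metis
  define M where "M = mat n n (\<lambda>(i,j). g i j)"
  have M: "M \<in> carrier_mat n n" by (simp add: M_def)
  have "(\<lambda>k. opn n (s k - M)) \<longlonglongrightarrow> 0"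
  proof (rule tendsto_sandwich[OF _ _ tendsto_const])
    show "\<forall>\<^sub>F k in sequentially. 0 \<le> opn n (s k - M)"
      using M s by (auto intro!: opn_nonneg always_eventually)
    have "opn n (s k - M) \<le> (\<Sum>i<n. \<Sum>j<n. cmod (s k $$ (i,j) - g i j))" for k
      using opn_le_sum[OF minus_carrier_mat[OF M], of "s k"] s[of k] by (simp add: M_def)
    then show "\<forall>\<^sub>F k in sequentially. opn n (s k - M) \<le> (\<Sum>i<n. \<Sum>j<n. cmod (s k $$ (i,j) - g i j))"
      by simp
    show "(\<lambda>k. \<Sum>i<n. \<Sum>j<n. cmod (s k $$ (i,j) - g i j)) \<longlonglongrightarrow> 0"
      using g by (intro tendsto_null_sum tendsto_norm_zero LIM_zero) auto
  qed
  then show "\<exists>x\<in>carrier_mat n n. (\<lambda>k. opn n (s k \<ominus>\<^bsub>L_alg n\<^esub> x)) \<longlonglongrightarrow> 0"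
    by (intro bexI[OF _ M]) (simp add: L_minus[OF s M])
next
  fix A B :: "complex mat" assume A: "A \<in> carrier_mat n n" and B: "B \<in> carrier_mat n n"
  show "mat_adjoint (A + B) = mat_adjoint A + mat_adjoint B"
    by (rule eq_matI) (use A B adjoint_dim[OF A] adjoint_dim[OF B] adjoint_dim[of "A + B" n] in
      \<open>auto simp: adjoint_index[of _ n]\<close>)
  show "mat_adjoint (A * B) = mat_adjoint B * mat_adjoint A"
  proof (rule eq_matI)
    fix i j assume ij: "i < dim_row (mat_adjoint B * mat_adjoint A)" "j < dim_col (mat_adjoint B * mat_adjoint A)"
    then show "mat_adjoint (A * B) $$ (i,j) = (mat_adjoint B * mat_adjoint A) $$ (i,j)"
      using A B adjoint_dim[OF A] adjoint_dim[OF B]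
      by (simp add: adjoint_index[of _ n] scalar_prod_def cnj_sum mult.commute)
  qed (use A B adjoint_dim[OF A] adjoint_dim[OF B] adjoint_dim[of "A * B" n] in auto)
next
  fix A :: "complex mat" and c assume A: "A \<in> carrier_mat n n"
  show "mat_adjoint (c \<cdot>\<^sub>m A) = cnj c \<cdot>\<^sub>m mat_adjoint A"
    by (rule eq_matI) (use A adjoint_dim[OF A] adjoint_dim[of "c \<cdot>\<^sub>m A" n] in
      \<open>auto simp: adjoint_index[of _ n]\<close>)
  show "c \<cdot>\<^sub>m A \<in> carrier_mat n n" using A by simp
  show "1 \<cdot>\<^sub>m A = A" by (intro eq_matI) auto
  show "(c + d) \<cdot>\<^sub>m A = c \<cdot>\<^sub>m A + d \<cdot>\<^sub>m A" for d by (rule add_smult_distrib_right_mat[OF A])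
  show "(c * d) \<cdot>\<^sub>m A = c \<cdot>\<^sub>m (d \<cdot>\<^sub>m A)" for d by (intro eq_matI) auto
  fix B :: "complex mat" assume B: "B \<in> carrier_mat n n"
  show "c \<cdot>\<^sub>m (A + B) = c \<cdot>\<^sub>m A + c \<cdot>\<^sub>m B" by (rule add_smult_distrib_left_mat[OF A B])
  show "(c \<cdot>\<^sub>m A) * B = c \<cdot>\<^sub>m (A * B)" by (rule mult_smult_assoc_mat[OF A B])
  show "A * (c \<cdot>\<^sub>m B) = c \<cdot>\<^sub>m (A * B)" by (rule mult_smult_distrib[OF A B])
  show "mat_adjoint A \<in> carrier_mat n n" using A by (rule adjoint_dim)
  show "mat_adjoint (mat_adjoint A) = A" using A by (rule mat_adj_adj)
  show "opn n (A + B) \<le> opn n A + opn n B" by (rule opn_add[OF A B])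
  show "opn n (A * B) \<le> opn n A * opn n B" by (rule opn_mult[OF A B])
qed

lemma L_finsum_index:
  assumes "\<And>i. i < (k::nat) \<Longrightarrow> f i \<in> carrier_mat n n" "p < n" "q < n"
  shows "(\<Oplus>\<^bsub>L_alg n\<^esub>i\<in>{..<k}. f i) $$ (p,q) = (\<Sum>i<k. f i $$ (p,q))"
proof -
  interpret ring "L_alg n" by (rule L_ring)
  show ?thesis using assms
  proof (induction k)
    case 0 then show ?case by (simp add: L_simps)
  next
    case (Suc k)
    have "(\<Oplus>\<^bsub>L_alg n\<^esub>i\<in>{..<k}. f i) \<in> carrier (L_alg n)"
      using Suc.prems by (intro finsum_closed) (auto simp: L_simps)
    moreover have "(\<Oplus>\<^bsub>L_alg n\<^esub>i\<in>{..<Suc k}. f i) = f k + (\<Oplus>\<^bsub>L_alg n\<^esub>i\<in>{..<k}. f i)"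
      using Suc.prems by (subst lessThan_Suc, subst finsum_insert) (auto simp: L_simps)
    ultimately show ?case using Suc.IH Suc.prems by (auto simp: L_simps)
  qed
qed

definition elem_tensor :: "'a topology \<Rightarrow> ('a \<Rightarrow> complex) \<Rightarrow> complex mat \<Rightarrow> ('a \<Rightarrow> complex mat)" where
  "elem_tensor X a S = (\<lambda>x\<in>topspace X. a x \<cdot>\<^sub>m S)"

theorem cstar_tensor_cont_alg:
  assumes X: "compact_space X"
  shows "cstar_tensor (C_alg X) (L_alg n) (cont_alg X (L_alg n)) (elem_tensor X)"
proof -
  interpret B: cstar_algebra "L_alg n" by (rule L_cstar)
  interpret PL: cont_alg_loc "L_alg n" X
    by (intro cont_alg_loc.intro L_cstar cont_alg_loc_axioms.intro X)
  interpret PC: cont_alg_loc complex_alg X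
    by (intro cont_alg_loc.intro complex_cstar cont_alg_loc_axioms.intro X)
  interpret P: cstar_algebra "cont_alg X (L_alg n)" by (rule PL.P_cstar)
  let ?T = "topspace X" and ?P = "cont_alg X (L_alg n)"
  have tc: "elem_tensor X a S \<in> carrier ?P" if a: "a \<in> carrier (C_alg X)" and S: "S \<in> carrier_mat n n" for a S
    unfolding elem_tensor_def
  proof (rule PL.P_restrictI)
    fix x assume x: "x \<in> ?T"
    have "((\<lambda>y. cmod (a y - a x)) \<longlongrightarrow> 0) (atin X x)"
      using PC.P_carrier_lim[OF a[unfolded C_alg_eq] x] unfolding complex_minus by (simp add: complex_alg_def)
    then have lim: "((\<lambda>y. cmod (a y - a x) * opn n S) \<longlongrightarrow> 0) (atin X x)" by (rule tendsto_mult_left_zero)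
    show "((\<lambda>y. opn n (a y \<cdot>\<^sub>m S \<ominus>\<^bsub>L_alg n\<^esub> a x \<cdot>\<^sub>m S)) \<longlongrightarrow> 0) (atin X x)"
    proof (rule PL.lim_squeeze[OF _ _ lim])
      fix y
      have "opn n (a y \<odot>\<^bsub>L_alg n\<^esub> S \<ominus>\<^bsub>L_alg n\<^esub> a x \<odot>\<^bsub>L_alg n\<^esub> S) = opn n ((a y - a x) \<odot>\<^bsub>L_alg n\<^esub> S)"
        using S by (subst B.smult_diff_l) (simp_all add: L_simps)
      also have "\<dots> = cmod (a y - a x) * opn n S"
        using S by (intro B.nrm_smult) (simp add: L_simps)
      finally show "opn n (a y \<cdot>\<^sub>m S \<ominus>\<^bsub>L_alg n\<^esub> a x \<cdot>\<^sub>m S) \<le> cmod (a y - a x) * opn n S"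
        by (simp add: L_simps)
      show "a y \<cdot>\<^sub>m S \<ominus>\<^bsub>L_alg n\<^esub> a x \<cdot>\<^sub>m S \<in> carrier (L_alg n)"
        using S by (intro B.minus_closed) (auto simp: L_simps)
    qed
  qed (use S in \<open>auto simp: L_simps\<close>)
  have C_simps: "(a \<oplus>\<^bsub>C_alg X\<^esub> b) = (\<lambda>x\<in>?T. a x + b x)" "(a \<otimes>\<^bsub>C_alg X\<^esub> b) = (\<lambda>x\<in>?T. a x * b x)"
     "(c \<odot>\<^bsub>C_alg X\<^esub> a) = (\<lambda>x\<in>?T. c * a x)" "adj (C_alg X) a = (\<lambda>x\<in>?T. cnj (a x))"
     "\<zero>\<^bsub>C_alg X\<^esub> = (\<lambda>x\<in>?T. 0)" for a b c
    by (auto simp: C_alg_def)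
  show ?thesis
  proof (intro cstar_tensor.intro cstar_tensor_axioms.intro C_alg_cstar[OF X] L_cstar PL.P_cstar)
    fix k :: nat and u v and i :: nat
    assume u: "\<And>i. i < k \<Longrightarrow> u i \<in> carrier (C_alg X)" and v: "\<And>i. i < k \<Longrightarrow> v i \<in> carrier (L_alg n)"
      and ind: "lin_indep_family (L_alg n) k v" 
      and z: "(\<Oplus>\<^bsub>?P\<^esub>i\<in>{..<k}. elem_tensor X (u i) (v i)) = \<zero>\<^bsub>?P\<^esub>" and i: "i < k"
    have "u i x = 0" if x: "x \<in> ?T" for x
    proof -
      have "(\<Oplus>\<^bsub>L_alg n\<^esub>i\<in>{..<k}. elem_tensor X (u i) (v i) x) = \<zero>\<^bsub>L_alg n\<^esub>"
        using PL.P_finsum[of k "\<lambda>i. elem_tensor X (u i) (v i)" x] tc u v z x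
        by (simp add: L_simps PL.P_val)
      also have "(\<Oplus>\<^bsub>L_alg n\<^esub>i\<in>{..<k}. elem_tensor X (u i) (v i) x) = (\<Oplus>\<^bsub>L_alg n\<^esub>i\<in>{..<k}. u i x \<odot>\<^bsub>L_alg n\<^esub> v i)"
        using x by (simp add: elem_tensor_def L_simps)
      finally show ?thesis using ind[unfolded lin_indep_family_def, rule_format, of "\<lambda>i. u i x" i] i by blast
    qed
    then show "u i = \<zero>\<^bsub>C_alg X\<^esub>"
      using u[OF i] by (auto simp: C_simps C_alg_def extensional_def)
  next
    fix F and e :: real assume F: "F \<in> carrier ?P" and e: "e > 0"
    define u where "u m = (\<lambda>x\<in>?T. F x $$ (m div n, m mod n))" for m
    define v where "v m = mat n n (\<lambda>(p,q). if m = p * n + q then 1 else 0 :: complex)" for m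
    have Fv: "F x \<in> carrier_mat n n" if "x \<in> ?T" for x using PL.P_carrier_val[OF F that] by (simp add: L_simps)
    have ij: "m div n < n" "m mod n < n" if "m < n * n" for m
      using that by (auto simp: less_mult_imp_div_less intro!: mod_less_divisor gr0I)
    have u: "u m \<in> carrier (C_alg X)" if m: "m < n * n" for m
      unfolding C_alg_eq u_def
    proof (rule PC.P_restrictI)
      fix x assume x: "x \<in> ?T"
      show "((\<lambda>y. nrm complex_alg (F y $$ (m div n, m mod n) \<ominus>\<^bsub>complex_alg\<^esub> F x $$ (m div n, m mod n))) \<longlongrightarrow> 0) (atin X x)"
      proof (rule PC.lim_squeeze[OF _ _ PL.P_carrier_lim[OF F x]])
        fix y assume y: "y \<in> ?T"
        show "nrm complex_alg (F y $$ (m div n, m mod n) \<ominus>\<^bsub>complex_alg\<^esub> F x $$ (m div n, m mod n)) \<le> opn n (F y \<ominus>\<^bsub>L_alg n\<^esub> F x)"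
          using opn_entry[OF minus_carrier_mat[OF Fv[OF x]] ij[OF m], of "F y"] ij[OF m] Fv[OF x] Fv[OF y]
          unfolding complex_minus L_minus[OF Fv[OF y] Fv[OF x]] by (simp add: complex_alg_def)
      qed (simp add: complex_alg_def)
    qed (simp add: complex_alg_def)
    have v: "v m \<in> carrier (L_alg n)" for m by (simp add: v_def L_simps)
    have tc': "elem_tensor X (u i) (v i) \<in> carrier ?P" if "i < n * n" for i
      using tc u[OF that] v by (simp add: L_simps)
    have sum: "(\<Oplus>\<^bsub>?P\<^esub>i\<in>{..<n*n}. elem_tensor X (u i) (v i)) \<in> carrier ?P"
      using tc' by (intro P.finsum_closed) auto
    have "F = (\<Oplus>\<^bsub>?P\<^esub>i\<in>{..<n*n}. elem_tensor X (u i) (v i))"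
    proof (rule PL.P_ext[OF F sum])
      fix x assume x: "x \<in> ?T"
      have "(\<Oplus>\<^bsub>?P\<^esub>i\<in>{..<n*n}. elem_tensor X (u i) (v i)) x = (\<Oplus>\<^bsub>L_alg n\<^esub>i\<in>{..<n*n}. elem_tensor X (u i) (v i) x)"
        using tc' x by (intro PL.P_finsum) auto
      also have "\<dots> = F x"
      proof (rule eq_matI)
        fix p q assume "p < dim_row (F x)" "q < dim_col (F x)"
        then have pq: "p < n" "q < n" using Fv[OF x] by auto
        have lt: "p * n + q < n * n"
        proof -
          have "p * n + q < p * n + n" using pq by simp
          also have "\<dots> = Suc p * n" by simp
          also have "\<dots> \<le> n * n" using pq by (intro mult_le_mono1) simp
          finally show ?thesis .
        qed
        have "(\<Oplus>\<^bsub>L_alg n\<^esub>i\<in>{..<n*n}. elem_tensor X (u i) (v i) x) $$ (p,q) = (\<Sum>i<n*n. elem_tensor X (u i) (v i) x $$ (p,q))"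
          using x v by (intro L_finsum_index pq) (auto simp: elem_tensor_def L_simps)
        also have "\<dots> = (\<Sum>i<n*n. if i = p * n + q then F x $$ (p,q) else 0)"
          using pq x by (intro sum.cong) (auto simp: elem_tensor_def v_def u_def)
        also have "\<dots> = F x $$ (p,q)" using lt by simp
        finally show "(\<Oplus>\<^bsub>L_alg n\<^esub>i\<in>{..<n*n}. elem_tensor X (u i) (v i) x) $$ (p,q) = F x $$ (p,q)" .
      next
        have "(\<Oplus>\<^bsub>L_alg n\<^esub>i\<in>{..<n*n}. elem_tensor X (u i) (v i) x) \<in> carrier (L_alg n)"
          using x v by (intro B.finsum_closed) (auto simp: elem_tensor_def L_simps)
        then show "dim_row (\<Oplus>\<^bsub>L_alg n\<^esub>i\<in>{..<n*n}. elem_tensor X (u i) (v i) x) = dim_row (F x)"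
          "dim_col (\<Oplus>\<^bsub>L_alg n\<^esub>i\<in>{..<n*n}. elem_tensor X (u i) (v i) x) = dim_col (F x)"
          using Fv[OF x] by (auto simp: L_simps)
      qed
      finally show "F x = (\<Oplus>\<^bsub>?P\<^esub>i\<in>{..<n*n}. elem_tensor X (u i) (v i)) x" by simp
    qed
    then have "nrm ?P (F \<ominus>\<^bsub>?P\<^esub> (\<Oplus>\<^bsub>?P\<^esub>i\<in>{..<n*n}. elem_tensor X (u i) (v i))) < e"
      using e P.minus_eq_zero_iff[OF F sum] P.nrm_zero by simp
    then show "\<exists>k u v. (\<forall>i<k. u i \<in> carrier (C_alg X) \<and> v i \<in> carrier (L_alg n)) \<and>
        nrm ?P (F \<ominus>\<^bsub>?P\<^esub> (\<Oplus>\<^bsub>?P\<^esub>i\<in>{..<k::nat}. elem_tensor X (u i) (v i))) < e"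
      using u v by blast
  next
    fix a b S S' assume ab: "a \<in> carrier (C_alg X)" "b \<in> carrier (C_alg X)" "S \<in> carrier (L_alg n)" "S' \<in> carrier (L_alg n)"
    then have S: "S \<in> carrier_mat n n" "S' \<in> carrier_mat n n" by (auto simp: L_simps)
    have "(x \<cdot>\<^sub>m S) * (y \<cdot>\<^sub>m S') = (x * y) \<cdot>\<^sub>m (S * S')" for x y
      using S by (simp add: mult_smult_distrib[of _ n n] mult_smult_assoc_mat[of _ n n])
        (intro eq_matI; simp)
    then show "elem_tensor X a S \<otimes>\<^bsub>?P\<^esub> elem_tensor X b S' = elem_tensor X (a \<otimes>\<^bsub>C_alg X\<^esub> b) (S \<otimes>\<^bsub>L_alg n\<^esub> S')"
      unfolding PL.P_simps C_simps L_simps elem_tensor_def by (intro restrict_ext) simp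
  next
    fix a b S assume ab: "a \<in> carrier (C_alg X)" "b \<in> carrier (C_alg X)" "S \<in> carrier (L_alg n)"
    then have S: "S \<in> carrier_mat n n" by (simp add: L_simps)
    show "elem_tensor X (a \<oplus>\<^bsub>C_alg X\<^esub> b) S = elem_tensor X a S \<oplus>\<^bsub>?P\<^esub> elem_tensor X b S"
      unfolding PL.P_simps C_simps L_simps elem_tensor_def
      by (intro restrict_ext) (simp add: add_smult_distrib_right_mat[OF S])
  next
    fix a S S' assume ab: "a \<in> carrier (C_alg X)" "S \<in> carrier (L_alg n)" "S' \<in> carrier (L_alg n)"
    then have S: "S \<in> carrier_mat n n" "S' \<in> carrier_mat n n" by (simp_all add: L_simps)
    show "elem_tensor X a (S \<oplus>\<^bsub>L_alg n\<^esub> S') = elem_tensor X a S \<oplus>\<^bsub>?P\<^esub> elem_tensor X a S'"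
      unfolding PL.P_simps C_simps L_simps elem_tensor_def
      by (intro restrict_ext) (simp add: add_smult_distrib_left_mat[OF S])
  next
    fix a S c assume ab: "a \<in> carrier (C_alg X)" "S \<in> carrier (L_alg n)"
    then have S: "S \<in> carrier_mat n n" by (simp add: L_simps)
    show "elem_tensor X a S \<in> carrier ?P" using ab S by (simp add: tc)
    have m: "(x * y) \<cdot>\<^sub>m S = x \<cdot>\<^sub>m (y \<cdot>\<^sub>m S)" for x y by (intro eq_matI) auto
    show "elem_tensor X (c \<odot>\<^bsub>C_alg X\<^esub> a) S = c \<odot>\<^bsub>?P\<^esub> elem_tensor X a S"
      unfolding PL.P_simps C_simps L_simps elem_tensor_def by (intro restrict_ext) (simp add: m)
    show "elem_tensor X a (c \<odot>\<^bsub>L_alg n\<^esub> S) = c \<odot>\<^bsub>?P\<^esub> elem_tensor X a S"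
      unfolding PL.P_simps C_simps L_simps elem_tensor_def
      by (intro restrict_ext) (simp add: m[symmetric] mult.commute)
    show "adj ?P (elem_tensor X a S) = elem_tensor X (adj (C_alg X) a) (adj (L_alg n) S)"
      unfolding PL.P_simps C_simps L_simps elem_tensor_def
      using B.adj_smult[OF ab(2), unfolded L_simps] by (intro restrict_ext) simp
  qed
qed

end

theory Submission
  imports Defs
begin

text \<open>The loop is a commutator of the two circles. It is quantum nullhomotopic already for
  a two-dimensional H. A homomorphism from C(T) to L(H) is a pair of points of T, attached to two orthogonal
  lines. A loop f acting by scalars moves both points along f at once; we may let the points
  run one after the other, and between the two runs, while both of them rest at the base point, rotate
  the lines. In this way the points that run along the first circle all get attached to one
  line and those that run along the second circle to the orthogonal one, and then the two motions commute
  and fill a square. The loop is not nullhomotopic, because the universal abelian cover of the wedge is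
  the grid of the points of the plane with an integral coordinate, in which the commutator lifts
  to the boundary of a unit square.\<close>

section \<open>Continuous families of matrices\<close>

lemma L_minus_entries:
  assumes "A \<in> carrier_mat n n" "B \<in> carrier_mat n n" "i < n" "j < n"
  shows "(A \<ominus>\<^bsub>L_alg n\<^esub> B) $$ (i,j) = A $$ (i,j) - B $$ (i,j)"
  using assms by (simp add: L_minus)

text \<open>The operator norm dominates every entry and is at most the sum of the moduli of the
  entries, so continuity in norm reduces to continuity of finitely many scalar functions.\<close>

lemma cont_alg_L_carrier_iff:
  assumes X: "compact_space X"
  shows "F \<in> carrier (cont_alg X (L_alg n)) \<longleftrightarrow>
    F \<in> topspace X \<rightarrow>\<^sub>E carrier_mat n n \<and>
    (\<forall>i<n. \<forall>j<n. continuous_map X euclidean (\<lambda>x. F x $$ (i,j)))" (is "?L \<longleftrightarrow> ?R")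
proof -
  interpret PL: cont_alg_loc "L_alg n" X
    by (intro cont_alg_loc.intro L_cstar cont_alg_loc_axioms.intro X)
  show ?thesis
  proof
    assume F: ?L
    have Fv: "F x \<in> carrier_mat n n" if "x \<in> topspace X" for x
      using PL.P_carrier_val[OF F that] by (simp add: L_simps)
    have "continuous_map X euclidean (\<lambda>x. F x $$ (i,j))" if ij: "i < n" "j < n" for i j
      unfolding continuous_map_atin
    proof
      fix x assume x: "x \<in> topspace X"
      have "((\<lambda>y. F y $$ (i,j) - F x $$ (i,j)) \<longlongrightarrow> 0) (atin X x)"
      proof (rule Lim_null_comparison[OF _ PL.P_carrier_lim[OF F x]], rule eventually_mono[OF PL.ev_top])
        fix y assume y: "y \<in> topspace X"
        show "norm (F y $$ (i,j) - F x $$ (i,j)) \<le> opn n (F y \<ominus>\<^bsub>L_alg n\<^esub> F x)"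
          using opn_entry[OF minus_carrier_mat[OF Fv[OF x]] ij, of "F y"] ij Fv[OF x] Fv[OF y]
          unfolding L_minus[OF Fv[OF y] Fv[OF x]] by simp
      qed
      then show "limitin euclidean (\<lambda>x. F x $$ (i,j)) (F x $$ (i,j)) (atin X x)"
        using LIM_zero_cancel by auto
    qed
    moreover have "F \<in> topspace X \<rightarrow>\<^sub>E carrier_mat n n"
      using F by (simp add: cont_alg_def L_simps)
    ultimately show ?R by blast
  next
    assume R: ?R
    then have Fv: "F x \<in> carrier_mat n n" if "x \<in> topspace X" for x using that by blast
    show ?L
    proof (rule PL.P_I)
      fix x assume x: "x \<in> topspace X"
      have "((\<lambda>y. \<Sum>i<n. \<Sum>j<n. cmod (F y $$ (i,j) - F x $$ (i,j))) \<longlongrightarrow> 0) (atin X x)"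
      proof (intro tendsto_null_sum tendsto_norm_zero LIM_zero)
        fix i j assume "i \<in> {..<n}" "j \<in> {..<n}"
        then show "((\<lambda>y. F y $$ (i,j)) \<longlongrightarrow> F x $$ (i,j)) (atin X x)"
          using R x by (auto simp: continuous_map_atin)
      qed
      then show "((\<lambda>y. opn n (F y \<ominus>\<^bsub>L_alg n\<^esub> F x)) \<longlongrightarrow> 0) (atin X x)"
      proof (rule PL.lim_squeeze[rotated 2])
        fix y assume y: "y \<in> topspace X"
        note c = Fv[OF y] Fv[OF x]
        show "opn n (F y \<ominus>\<^bsub>L_alg n\<^esub> F x) \<le> (\<Sum>i<n. \<Sum>j<n. cmod (F y $$ (i,j) - F x $$ (i,j)))"
          using opn_le_sum[of "F y \<ominus>\<^bsub>L_alg n\<^esub> F x" n] c by (simp add: L_minus L_minus_entries minus_carrier_mat)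
        show "F y \<ominus>\<^bsub>L_alg n\<^esub> F x \<in> carrier (L_alg n)"
          using c by (simp add: L_minus L_simps minus_carrier_mat)
      qed
    qed (use R in \<open>auto simp: L_simps PiE_iff\<close>)
  qed
qed

text \<open>With \<open>D2\<close> as \<open>X\<close> and its boundary circle as \<open>S\<close>,
  this is the map \<open>r\<close> in the definition of quantum nullhomotopy.\<close>

lemma star_hom_restrict_cont_alg:
  assumes X: "compact_space X" and S: "compact_space (subtopology X S)" "S \<subseteq> topspace X"
  shows "(\<lambda>F. restrict F S) \<in> star_hom (cont_alg X (L_alg n)) (cont_alg (subtopology X S) (L_alg n))"
proof -
  have t: "topspace (subtopology X S) = S" using S(2) by auto
  have r: "S \<inter> topspace X = S" "topspace X \<inter> S = S" using S(2) by auto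
  have cl: "restrict F S \<in> carrier (cont_alg (subtopology X S) (L_alg n))"
    if "F \<in> carrier (cont_alg X (L_alg n))" for F
  proof -
    have "continuous_map (subtopology X S) euclidean (\<lambda>x. restrict F S x $$ (i,j))"
      if "i < n" "j < n" for i j
    proof (rule continuous_map_eq)
      show "continuous_map (subtopology X S) euclidean (\<lambda>x. F x $$ (i,j))"
        using \<open>F \<in> _\<close> that by (simp add: cont_alg_L_carrier_iff[OF X] continuous_map_from_subtopology)
    qed (auto simp: t)
    then show ?thesis
      using that S(2) unfolding cont_alg_L_carrier_iff[OF X] cont_alg_L_carrier_iff[OF S(1)] t
      by (auto simp: PiE_iff)
  qed
  show ?thesis
    unfolding star_hom_def
    by (auto intro!: ring_hom_memI cl) (auto simp: cont_alg_def r restrict_def fun_eq_iff subsetD[OF S(2)])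
qed

text \<open>The operations of \<open>cont_alg\<close> are pointwise, so a homomorphism into it can
  be built from a family of homomorphisms into matrices, checked one point of \<open>X\<close> at a
  time. Only continuity of the entries links the points.\<close>

lemma star_hom_C_alg_pointwise:
  assumes T: "compact_space T" and X: "compact_space X"
    and cont: "\<And>a i j. \<lbrakk>a \<in> carrier (C_alg T); i < n; j < n\<rbrakk>
      \<Longrightarrow> continuous_map X euclidean (\<lambda>w. \<phi> w a $$ (i,j))"
    and hom: "\<And>w. w \<in> topspace X \<Longrightarrow> \<phi> w \<in> star_hom (C_alg T) (L_alg n)"
  shows "(\<lambda>a. \<lambda>w\<in>topspace X. \<phi> w a) \<in> star_hom (C_alg T) (cont_alg X (L_alg n))"
proof -
  interpret T: cstar_algebra "C_alg T" by (rule C_alg_cstar[OF T])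
  interpret PL: cont_alg_loc "L_alg n" X
    by (intro cont_alg_loc.intro L_cstar cont_alg_loc_axioms.intro X)
  have h: "\<phi> w \<in> Ring.ring_hom (C_alg T) (L_alg n)"
    "\<And>c a. a \<in> carrier (C_alg T) \<Longrightarrow> \<phi> w (c \<odot>\<^bsub>C_alg T\<^esub> a) = c \<odot>\<^bsub>L_alg n\<^esub> \<phi> w a"
    "\<And>a. a \<in> carrier (C_alg T) \<Longrightarrow> \<phi> w (adj (C_alg T) a) = adj (L_alg n) (\<phi> w a)"
    if "w \<in> topspace X" for w using hom[OF that] by (auto simp: star_hom_def)
  have cl: "(\<lambda>w\<in>topspace X. \<phi> w a) \<in> carrier (cont_alg X (L_alg n))" if a: "a \<in> carrier (C_alg T)" for a
    unfolding cont_alg_L_carrier_iff[OF X]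
  proof (intro conjI allI impI)
    show "(\<lambda>w\<in>topspace X. \<phi> w a) \<in> topspace X \<rightarrow>\<^sub>E carrier_mat n n"
      using ring_hom_closed[OF h(1) a] by (auto simp: L_simps)
    fix i j assume "i < n" "j < n"
    then show "continuous_map X euclidean (\<lambda>x. (\<lambda>w\<in>topspace X. \<phi> w a) x $$ (i,j))"
      by (intro continuous_map_eq[OF cont[OF a]]) auto
  qed
  show ?thesis
    unfolding star_hom_def
    by (auto intro!: ring_hom_memI cl restrict_ext
        simp: PL.P_simps T.smult_closed T.adj_closed h ring_hom_mult[OF h(1)] ring_hom_add[OF h(1)] ring_hom_one[OF h(1)])
qed

section \<open>Pairs of points on orthogonal lines\<close>

text \<open>The entries of the projection onto the line of slope angle \<open>\<sigma>\<close>.\<close>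

definition rank1 :: "real \<Rightarrow> nat \<Rightarrow> nat \<Rightarrow> complex" where
  "rank1 \<sigma> i j = of_real ((if i = 0 then cos \<sigma> else sin \<sigma>) * (if j = 0 then cos \<sigma> else sin \<sigma>))"

text \<open>The normal operator with eigenvalue \<open>x\<close> on the line of angle
  \<open>\<sigma>\<close> and eigenvalue \<open>y\<close> on the orthogonal line.\<close>

definition spectral :: "real \<Rightarrow> complex \<Rightarrow> complex \<Rightarrow> complex mat" where
  "spectral \<sigma> x y = mat 2 2 (\<lambda>(i,j). x * rank1 \<sigma> i j + y * (of_bool (i = j) - rank1 \<sigma> i j))"

lemma spectral_carrier [simp]: "spectral \<sigma> x y \<in> carrier_mat 2 2"
  by (simp add: spectral_def)

lemma spectral_one: "spectral \<sigma> 1 1 = 1\<^sub>m 2"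
  by (rule eq_matI) (auto simp: spectral_def)

lemma spectral_add: "spectral \<sigma> (x + x') (y + y') = spectral \<sigma> x y + spectral \<sigma> x' y'"
  by (rule eq_matI) (auto simp: spectral_def algebra_simps)

lemma spectral_smult: "spectral \<sigma> (c * x) (c * y) = c \<cdot>\<^sub>m spectral \<sigma> x y"
  by (rule eq_matI) (auto simp: spectral_def algebra_simps)

lemma spectral_adjoint: "spectral \<sigma> (cnj x) (cnj y) = mat_adjoint (spectral \<sigma> x y)"
proof -
  note d = adjoint_dim[OF spectral_carrier, of \<sigma> x y]
  show ?thesis
    by (rule eq_matI) (use d in \<open>auto simp: adjoint_index[OF spectral_carrier], auto simp: spectral_def rank1_def\<close>)
qed

lemma rank1_idempotent: "rank1 \<sigma> i 0 * rank1 \<sigma> 0 j + rank1 \<sigma> i 1 * rank1 \<sigma> 1 j = rank1 \<sigma> i j"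
proof -
  have "u * cos \<sigma> * (cos \<sigma> * v) + u * sin \<sigma> * (sin \<sigma> * v) = u * v" for u v
  proof -
    have "u * cos \<sigma> * (cos \<sigma> * v) + u * sin \<sigma> * (sin \<sigma> * v) = u * v * (cos \<sigma> * cos \<sigma> + sin \<sigma> * sin \<sigma>)"
      by (simp add: algebra_simps del: sin_cos_squared_add3)
    then show ?thesis by (simp only: sin_cos_squared_add3 mult_1_right)
  qed
  then show ?thesis by (simp only: rank1_def of_real_mult[symmetric] of_real_add[symmetric]) simp
qed

lemma spectral_mult: "spectral \<sigma> (x * x') (y * y') = spectral \<sigma> x y * spectral \<sigma> x' y'"
proof (rule eq_matI)
  fix i j assume "i < dim_row (spectral \<sigma> x y * spectral \<sigma> x' y')" "j < dim_col (spectral \<sigma> x y * spectral \<sigma> x' y')"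
  then have ij: "i < 2" "j < 2" by (auto simp: spectral_def)
  then have "(spectral \<sigma> x y * spectral \<sigma> x' y') $$ (i, j)
      = (\<Sum>k<2. spectral \<sigma> x y $$ (i,k) * spectral \<sigma> x' y' $$ (k,j))"
    by (simp add: spectral_def scalar_prod_def lessThan_atLeast0)
  also have "\<dots> = spectral \<sigma> x y $$ (i,0) * spectral \<sigma> x' y' $$ (0,j) + spectral \<sigma> x y $$ (i,1) * spectral \<sigma> x' y' $$ (1,j)"
    by (simp add: numeral_2_eq_2)
  \<comment> \<open>With p the projection, the factors are y + (x - y) p and y' + (x' - y') p. Their
    product differs from the wanted operator by a multiple of p p - p, which vanishes because p is
    idempotent.\<close>
  also have "\<dots> = spectral \<sigma> (x * x') (y * y') $$ (i, j) + (x - y) * (x' - y') *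
      (rank1 \<sigma> i 0 * rank1 \<sigma> 0 j + rank1 \<sigma> i 1 * rank1 \<sigma> 1 j - rank1 \<sigma> i j)"
  proof -
    have "i = 0 \<or> i = 1" "j = 0 \<or> j = 1" using ij by auto
    then show ?thesis by (elim disjE; simp add: spectral_def algebra_simps)
  qed
  finally show "spectral \<sigma> (x * x') (y * y') $$ (i, j) = (spectral \<sigma> x y * spectral \<sigma> x' y') $$ (i, j)"
    unfolding rank1_idempotent by simp
qed (auto simp: spectral_def)

text \<open>Evaluation at two points, diagonal in a fixed orthonormal basis: the algebra operations
  act separately on the two eigenvalues.\<close>

lemma star_hom_spectral:
  assumes "x \<in> topspace T" "y \<in> topspace T"
  shows "(\<lambda>a. spectral \<sigma> (a x) (a y)) \<in> star_hom (C_alg T) (L_alg 2)"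
proof -
  have "(\<lambda>a. spectral \<sigma> (a x) (a y)) \<in> Ring.ring_hom (C_alg T) (L_alg 2)"
    by (rule ring_hom_memI) (simp_all add: C_alg_def L_simps assms spectral_mult spectral_add spectral_one)
  then show ?thesis
    by (simp add: star_hom_def C_alg_def L_simps assms spectral_smult spectral_adjoint)
qed

section \<open>The commutator loop\<close>

definition circ :: "real \<Rightarrow> complex" where
  "circ x = cis (2 * pi * x)"

lemma norm_circ [simp]: "norm (circ x) = 1"
  by (simp add: circ_def)

lemma circ_eq_iff: "circ x = circ y \<longleftrightarrow> (\<exists>n::int. x = y + of_int n)"
proof -
  have "circ x = circ y \<longleftrightarrow> (\<exists>n::int. \<i> * of_real (2 * pi * x) = \<i> * of_real (2 * pi * y) + of_real (of_int (2 * n) * pi) * \<i>)"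
    by (simp add: circ_def cis_conv_exp exp_eq)
  also have "\<dots> \<longleftrightarrow> (\<exists>n::int. 2 * pi * x = 2 * pi * y + of_int (2 * n) * pi)"
    by (intro ex_cong1) (simp add: complex_eq_iff)
  also have "\<dots> \<longleftrightarrow> (\<exists>n::int. x = y + of_int n)"
  proof (intro ex_cong1)
    fix n :: int
    have "2 * pi * x = 2 * pi * y + of_int (2 * n) * pi \<longleftrightarrow> (2 * pi) * x = (2 * pi) * (y + of_int n)"
      by (simp add: algebra_simps)
    then show "2 * pi * x = 2 * pi * y + of_int (2 * n) * pi \<longleftrightarrow> x = y + of_int n"
      using pi_gt_zero by simp
  qed
  finally show ?thesis .
qed

definition clamp01 :: "real \<Rightarrow> real" where
  "clamp01 x = max 0 (min 1 x)"

lemma continuous_on_clamp01 [continuous_intros]: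
  "continuous_on S f \<Longrightarrow> continuous_on S (\<lambda>x. clamp01 (f x))"
  unfolding clamp01_def by (intro continuous_intros)

lemma continuous_on_circ [continuous_intros]:
  "continuous_on S f \<Longrightarrow> continuous_on S (\<lambda>x. circ (f x))"
  unfolding circ_def cis_conv_exp by (intro continuous_intros)

lemma circ_clamp01_eq_1: "x \<le> 0 \<or> 1 \<le> x \<Longrightarrow> circ (clamp01 x) = 1"
  by (auto simp: clamp01_def circ_def)

text \<open>For l = 0 both points k = 0 and k = 1 run once around the circle while x runs from -1/2 to 1/2;
  for l = 1 they do so one after the other, the point k = 0 while x is negative.\<close>

definition runner :: "real \<Rightarrow> real \<Rightarrow> real \<Rightarrow> complex" where
  "runner k l x = circ (clamp01 ((1 + l) * (x + 1/2) - k * l))"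

lemma norm_runner [simp]: "norm (runner k l x) = 1"
  unfolding runner_def by (rule norm_circ)

lemma continuous_on_runner [continuous_intros]:
  "\<lbrakk>continuous_on S l; continuous_on S x\<rbrakk> \<Longrightarrow> continuous_on S (\<lambda>w. runner k (l w) (x w))"
  unfolding runner_def by (intro continuous_intros)

text \<open>The argument of \<open>clamp01\<close> crosses [0,1] while (1 + l)(x + 1/2) goes from k
  l to k l + 1. For k between 0 and 1 this range lies within [0, 1 + l], so the motion takes place
  for x between -1/2 and 1/2.\<close>

lemma runner_eq_1:
  assumes "1/2 \<le> \<bar>x\<bar>" "0 \<le> k" "k \<le> 1" "0 \<le> l"
  shows "runner k l x = 1"
proof (cases "0 \<le> x")
  case True
  then have "(1 + l) * 1 \<le> (1 + l) * (x + 1/2)" using assms by (intro mult_left_mono) auto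
  moreover have "k * l \<le> 1 * l" using assms by (intro mult_right_mono) auto
  ultimately show ?thesis unfolding runner_def by (intro circ_clamp01_eq_1) auto
next
  case False
  then have "(1 + l) * (x + 1/2) \<le> 0" using assms by (intro mult_nonneg_nonpos) auto
  moreover have "0 \<le> k * l" using assms by simp
  ultimately show ?thesis unfolding runner_def by (intro circ_clamp01_eq_1) auto
qed

lemma runner_l_0: "runner k 0 x = runner 0 0 x"
  by (simp add: runner_def)

text \<open>When x is nonnegative, point 0 has completed its turn; when x is negative, point 1 has
  not started.\<close>

lemma runner_l_1: "runner 0 1 x = 1 \<or> runner 1 1 x = 1"
  unfolding runner_def by (cases "0 \<le> x") (auto intro: circ_clamp01_eq_1)

section \<open>Points of the wedge and its two circle coordinates\<close>

definition wedge_point :: "bool \<Rightarrow> complex \<Rightarrow> (bool \<times> complex) set" where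
  "wedge_point b z = wedge_rel (\<lambda>_. S1) (\<lambda>_. 1) UNIV `` {(b, z)}"

lemma continuous_map_wedge_point: "continuous_map S1 S1_wedge_S1 (wedge_point b)"
proof -
  have "continuous_map S1 S1_wedge_S1 ((\<lambda>u. wedge_rel (\<lambda>_::bool. S1) (\<lambda>_. 1) UNIV `` {u}) \<circ> (\<lambda>z. (b, z)))"
    by (rule continuous_map_compose[OF continuous_map_component_injection
          quotient_imp_continuous_map[OF quotient_map_wedge_sum]]) simp
  then show ?thesis by (simp add: wedge_point_def[abs_def] o_def)
qed

lemma wedge_point_in_topspace [simp]: "z \<in> sphere 0 1 \<Longrightarrow> wedge_point b z \<in> topspace S1_wedge_S1"
  using continuous_map_wedge_point[of b] by (auto simp: continuous_map_def)

lemma wedge_point_1: "wedge_point b 1 = wedge_point False 1"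
  unfolding wedge_point_def wedge_rel_def by auto

lemma wedge_point_cases:
  assumes "C \<in> topspace S1_wedge_S1"
  obtains b z where "z \<in> sphere 0 1" "C = wedge_point b z"
proof -
  have "C \<in> (\<lambda>u. wedge_rel (\<lambda>_::bool. S1) (\<lambda>_. 1) UNIV `` {u}) ` topspace (sum_topology (\<lambda>_::bool. S1) UNIV)"
    using assms quotient_imp_surjective_map[OF quotient_map_wedge_sum] by metis
  then show ?thesis using that by (auto simp: wedge_point_def)
qed

text \<open>The map that collapses the other circle to 1 is defined on the disjoint union. It takes
  the value 1 at both base points and therefore descends to the quotient.\<close>

lemma wedge_coordinate_exists:
  obtains u where "continuous_map S1_wedge_S1 euclidean u"
    "\<And>z b'. z \<in> sphere 0 1 \<Longrightarrow> u (wedge_point b' z) = (if b' = b then z else 1 :: complex)"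
proof -
  let ?S = "sum_topology (\<lambda>_::bool. S1) UNIV"
  let ?q = "\<lambda>u. wedge_rel (\<lambda>_::bool. S1) (\<lambda>_. 1) UNIV `` {u}"
  define h where "h w = (if fst w = b then snd w else 1 :: complex)" for w
  have c: "continuous_map S1 euclidean (\<lambda>x. h (b', x))" for b'
    by (cases "b' = b") (auto simp: h_def intro!: continuous_intros)
  have h: "continuous_map ?S euclidean h"
    unfolding continuous_map_def
  proof (intro conjI allI impI)
    fix U :: "complex set" assume "openin euclidean U"
    then have "openin S1 {x \<in> topspace S1. h (b', x) \<in> U}" for b'
      using openin_continuous_map_preimage[OF c] by blast
    then show "openin ?S {w \<in> topspace ?S. h w \<in> U}"
      unfolding openin_sum_topology by auto
  qed simp
  have eq: "h v = h w" if "v \<in> topspace ?S" "w \<in> topspace ?S" "?q v = ?q w" for v w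
  proof -
    have "(v, w) \<in> wedge_rel (\<lambda>_::bool. S1) (\<lambda>_. 1) UNIV"
      using that eq_equiv_class[OF _ equiv_wedge_rel] by metis
    then show ?thesis by (auto simp: wedge_rel_def h_def)
  qed
  obtain u where "continuous_map S1_wedge_S1 euclidean u" "\<And>w. w \<in> topspace ?S \<Longrightarrow> u (?q w) = h w"
    by (rule quotient_map_lift_exists[OF quotient_map_wedge_sum h]) (use eq in blast)+
  then show ?thesis by (intro that[of u]) (auto simp: wedge_point_def h_def)
qed

text \<open>Counterclockwise along the unit circle, Im rises on the right arc and falls on the left
  one, while Re falls on the top arc and rises on the bottom one. So each circle of the wedge is
  traversed once in either direction, alternating with the other circle: a commutator.\<close>

definition commutator_loop :: "complex \<Rightarrow> (bool \<times> complex) set" where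
  "commutator_loop z = (if \<bar>Im z\<bar> \<le> 1/2 then wedge_point False (runner 0 0 (Im z))
     else wedge_point True (runner 0 0 (Re z)))"

lemma sphere_Re_Im: "z \<in> sphere 0 1 \<Longrightarrow> 1/2 \<le> \<bar>Re z\<bar> \<or> 1/2 \<le> \<bar>Im z\<bar>"
  "\<lbrakk>z \<in> sphere 0 1; \<bar>Im z\<bar> \<le> 1/2\<rbrakk> \<Longrightarrow> 1/2 \<le> \<bar>Re z\<bar>"
  using cmod_le[of z] by auto

lemma loop_in_commutator_loop: "loop_in S1_wedge_S1 commutator_loop"
  unfolding loop_in_def commutator_loop_def
proof (rule continuous_map_cases_le)
  have c: "continuous_map (subtopology S1 A) S1_wedge_S1 (\<lambda>z. wedge_point b (runner 0 0 (p z)))"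
    if "continuous_on UNIV p" for A b p
  proof -
    have "continuous_map (subtopology S1 A) S1 (\<lambda>z. runner 0 0 (p z))"
      using continuous_on_subset[OF that] by (auto simp: subtopology_subtopology intro!: continuous_intros)
    then show ?thesis using continuous_map_compose[OF _ continuous_map_wedge_point[of b]] by (auto simp: o_def)
  qed
  show "continuous_map (subtopology S1 {x \<in> topspace S1. \<bar>Im x\<bar> \<le> 1/2}) S1_wedge_S1 (\<lambda>z. wedge_point False (runner 0 0 (Im z)))"
    "continuous_map (subtopology S1 {x \<in> topspace S1. 1/2 \<le> \<bar>Im x\<bar>}) S1_wedge_S1 (\<lambda>z. wedge_point True (runner 0 0 (Re z)))"
    by (intro c continuous_intros)+
  \<comment> \<open>At the seams both coordinates have absolute value at least 1/2, so both formulas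
    give the base point.\<close>
  show "wedge_point False (runner 0 0 (Im x)) = wedge_point True (runner 0 0 (Re x))"
    if "x \<in> topspace S1" "\<bar>Im x\<bar> = 1/2" for x
    using that sphere_Re_Im(2)[of x] by (simp add: runner_eq_1 wedge_point_1[of True])
qed (auto intro!: continuous_intros)

section \<open>The loop is not nullhomotopic\<close>

text \<open>A continuous logarithm on the disk provides some lift. On the boundary it differs from
  \<open>b\<close> by a continuous integer-valued function, which is constant because the circle is
  connected; subtracting this integer makes the lift agree with \<open>b\<close>.\<close>

lemma lift_to_real:
  assumes u: "continuous_on (cball (0::complex) 1) u" "\<And>z. z \<in> cball 0 1 \<Longrightarrow> cmod (u z) = 1"
    and b: "continuous_on (sphere 0 1) b" "\<And>z. z \<in> sphere 0 1 \<Longrightarrow> u z = circ (b z)"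
  obtains \<alpha> where "continuous_on (cball 0 1) \<alpha>" "\<And>z. z \<in> cball 0 1 \<Longrightarrow> u z = circ (\<alpha> z)"
    "\<And>z. z \<in> sphere 0 1 \<Longrightarrow> \<alpha> z = b z"
proof -
  obtain h where h: "continuous_on (cball 0 1) h" "\<And>z. z \<in> cball 0 1 \<Longrightarrow> u z = exp (h z)"
    using continuous_logarithm_on_cball[OF u(1)] u(2) by (metis norm_zero zero_neq_one)
  define \<alpha> where "\<alpha> z = Im (h z) / (2 * pi)" for z
  have \<alpha>: "continuous_on (cball 0 1) \<alpha>" unfolding \<alpha>_def by (intro continuous_intros h) auto
  have u\<alpha>: "u z = circ (\<alpha> z)" if z: "z \<in> cball 0 1" for z
  proof -
    have "exp (Re (h z)) = 1" using u(2)[OF z] h(2)[OF z] by (simp add: norm_exp_eq_Re)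
    then have "exp (h z) = cis (Im (h z))" by (simp add: exp_eq_polar)
    then show ?thesis using h(2)[OF z] by (simp add: circ_def \<alpha>_def)
  qed
  have int: "\<alpha> z - b z \<in> \<int>" if z: "z \<in> sphere 0 1" for z
  proof -
    have "circ (\<alpha> z) = circ (b z)" using z u\<alpha>[of z] b(2)[OF z] by simp
    then show ?thesis by (auto simp: circ_eq_iff)
  qed
  have "(\<lambda>z. \<alpha> z - b z) constant_on sphere (0::complex) 1"
  proof (rule continuous_discrete_range_constant)
    show "connected (sphere (0::complex) 1)" by (rule connected_sphere) simp
    show "continuous_on (sphere 0 1) (\<lambda>z. \<alpha> z - b z)"
      by (intro continuous_intros b continuous_on_subset[OF \<alpha>]) auto
    fix x :: complex assume x: "x \<in> sphere 0 1"
    have "1 \<le> norm ((\<alpha> y - b y) - (\<alpha> x - b x))" if "y \<in> sphere 0 1" "\<alpha> y - b y \<noteq> \<alpha> x - b x" for y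
      using Ints_nonzero_abs_ge1[OF Ints_diff[OF int[OF that(1)] int[OF x]]] that(2) by simp
    then show "\<exists>e>0. \<forall>y. y \<in> sphere 0 1 \<and> \<alpha> y - b y \<noteq> \<alpha> x - b x \<longrightarrow> e \<le> norm ((\<alpha> y - b y) - (\<alpha> x - b x))"
      by (intro exI[of _ 1]) auto
  qed
  then obtain k where k: "\<And>z. z \<in> sphere 0 1 \<Longrightarrow> \<alpha> z - b z = k" unfolding constant_on_def by blast
  have "k \<in> \<int>" using int[of 1] k[of 1] by simp
  then obtain m :: int where m: "k = of_int m" by (auto elim: Ints_cases)
  show ?thesis
  proof (rule that[of "\<lambda>z. \<alpha> z - k"])
    show "continuous_on (cball 0 1) (\<lambda>z. \<alpha> z - k)" by (intro continuous_intros \<alpha>)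
    show "u z = circ (\<alpha> z - k)" if "z \<in> cball 0 1" for z
    proof -
      have "circ (\<alpha> z) = circ (\<alpha> z - k)" unfolding circ_eq_iff by (rule exI[of _ m]) (simp add: m)
      then show ?thesis using u\<alpha>[OF that] by simp
    qed
    show "\<alpha> z - k = b z" if "z \<in> sphere 0 1" for z using k[OF that] by simp
  qed
qed

text \<open>Otherwise the normalised negative field maps the ball into the sphere. A Brouwer fixed
  point lies on the sphere, and there the field points inwards, against the hypothesis.\<close>

lemma vector_field_vanishes:
  fixes G :: "'a::euclidean_space \<Rightarrow> 'a"
  assumes G: "continuous_on (cball 0 1) G" and pos: "\<And>z. z \<in> sphere 0 1 \<Longrightarrow> 0 < inner (G z) z"
  shows "\<exists>z\<in>cball 0 1. G z = 0"
proof (rule ccontr)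
  assume "\<not> ?thesis"
  then have nz: "G z \<noteq> 0" if "z \<in> cball 0 1" for z using that by blast
  define f where "f z = - (G z /\<^sub>R norm (G z))" for z
  have n: "norm (f z) = 1" if "z \<in> cball 0 1" for z using nz[OF that] by (simp add: f_def)
  have "continuous_on (cball 0 1) f" unfolding f_def by (intro continuous_intros G) (use nz in auto)
  then obtain z where z: "z \<in> cball 0 1" "f z = z"
    using brouwer_ball[of 1 0 f] n by (auto simp: Pi_iff)
  then have s: "z \<in> sphere 0 1" using n[OF z(1)] by simp
  have "inner (f z) z = - ((inner (G z) z) / norm (G z))" by (simp add: f_def divide_inverse mult.commute)
  also have "\<dots> < 0" using pos[OF s] nz[OF z(1)] by simp
  finally show False using z(2) by (metis inner_ge_zero not_less)
qed

text \<open>The circle coordinates of a filling lift to a map from the disk to the plane. The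
  boundary values force this map to hit the centre of the unit square, but at every point of the
  wedge one coordinate is 1, which keeps the lift on the grid.\<close>

theorem not_nullhomotopic_commutator_loop: "\<not> nullhomotopic_loop S1_wedge_S1 commutator_loop"
proof
  assume "nullhomotopic_loop S1_wedge_S1 commutator_loop"
  then obtain g where g: "continuous_map D2 S1_wedge_S1 g" "\<And>z. z \<in> sphere 0 1 \<Longrightarrow> g z = commutator_loop z"
    unfolding nullhomotopic_loop_def by auto
  obtain u where u: "continuous_map S1_wedge_S1 euclidean u"
    "\<And>z b. z \<in> sphere 0 1 \<Longrightarrow> u (wedge_point b z) = (if b = True then z else 1)"
    using wedge_coordinate_exists by blast
  obtain v where v: "continuous_map S1_wedge_S1 euclidean v"
    "\<And>z b. z \<in> sphere 0 1 \<Longrightarrow> v (wedge_point b z) = (if b = False then z else 1)"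
    using wedge_coordinate_exists by blast
  have cases: "cmod (u (g z)) = 1 \<and> cmod (v (g z)) = 1 \<and> (u (g z) = 1 \<or> v (g z) = 1)" if "z \<in> cball 0 1" for z
  proof -
    have "g z \<in> topspace S1_wedge_S1" using g(1) that by (auto simp: continuous_map_def)
    then obtain b x where "x \<in> sphere 0 1" "g z = wedge_point b x" by (rule wedge_point_cases)
    then show ?thesis using u(2) v(2) by auto
  qed
  \<comment> \<open>Both formulas hold on the whole circle, without the case distinction of the
    loop: the coordinate that is not moving has absolute value at least 1/2, where its formula gives
    1.\<close>
  have bdry: "u (g z) = circ (clamp01 (Re z + 1/2))" "v (g z) = circ (clamp01 (Im z + 1/2))"
    if "z \<in> sphere 0 1" for z
  proof -
    have r: "circ (clamp01 (x + 1/2)) = runner 0 0 x" for x by (simp add: runner_def)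
    show "u (g z) = circ (clamp01 (Re z + 1/2))" "v (g z) = circ (clamp01 (Im z + 1/2))"
      unfolding r using that sphere_Re_Im[OF that]
      by (auto simp: g(2) commutator_loop_def u(2) v(2) runner_eq_1)
  qed
  have "continuous_on (cball 0 1) (u \<circ> g)" "continuous_on (cball 0 1) (v \<circ> g)"
    using continuous_map_compose[OF g(1) u(1)] continuous_map_compose[OF g(1) v(1)] by auto
  then have c: "continuous_on (cball 0 1) (\<lambda>z. u (g z))" "continuous_on (cball 0 1) (\<lambda>z. v (g z))"
    by (auto simp: o_def)
  obtain \<alpha> where \<alpha>: "continuous_on (cball 0 1) \<alpha>" "\<And>z. z \<in> cball 0 1 \<Longrightarrow> u (g z) = circ (\<alpha> z)"
    "\<And>z. z \<in> sphere 0 1 \<Longrightarrow> \<alpha> z = clamp01 (Re z + 1/2)"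
    by (rule lift_to_real[OF c(1), of "\<lambda>z. clamp01 (Re z + 1/2)"])
      (use cases bdry in \<open>auto intro!: continuous_intros\<close>)
  obtain \<beta> where \<beta>: "continuous_on (cball 0 1) \<beta>" "\<And>z. z \<in> cball 0 1 \<Longrightarrow> v (g z) = circ (\<beta> z)"
    "\<And>z. z \<in> sphere 0 1 \<Longrightarrow> \<beta> z = clamp01 (Im z + 1/2)"
    by (rule lift_to_real[OF c(2), of "\<lambda>z. clamp01 (Im z + 1/2)"])
      (use cases bdry in \<open>auto intro!: continuous_intros\<close>)
  \<comment> \<open>The lift, recentred so that the centre of the unit square becomes 0.\<close>
  define G where "G z = Complex (\<alpha> z - 1/2) (\<beta> z - 1/2)" for z
  have "continuous_on (cball 0 1) G"
    unfolding G_def by (intro continuous_on_Complex continuous_intros \<alpha> \<beta>)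
  moreover have "0 < inner (G z) z" if z: "z \<in> sphere 0 1" for z
  proof -
    \<comment> \<open>Here \<open>clamp01 (x + 1/2) - 1/2\<close> is x cut off to [-1/2, 1/2], so it
      has the sign of x and \<open>G\<close> points outwards on the boundary.\<close>
    have p: "0 \<le> (clamp01 (x + 1/2) - 1/2) * x" "x \<noteq> 0 \<Longrightarrow> 0 < (clamp01 (x + 1/2) - 1/2) * x" for x
      by (cases x "0::real" rule: linorder_cases; force simp: clamp01_def max_def min_def
          intro: mult_pos_pos mult_neg_neg)+
    have "Re z \<noteq> 0 \<or> Im z \<noteq> 0" using z by (auto simp: cmod_def)
    then show ?thesis
      using p[of "Re z"] p[of "Im z"] by (auto simp: G_def inner_complex_def \<alpha>(3)[OF z] \<beta>(3)[OF z] add_pos_nonneg add_nonneg_pos)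
  qed
  ultimately obtain z where z: "z \<in> cball 0 1" "G z = 0" using vector_field_vanishes by blast
  then have "\<alpha> z = 1/2" "\<beta> z = 1/2" by (simp_all add: G_def complex_eq_iff)
  \<comment> \<open>Both coordinates equal \<open>circ (1/2)\<close>, that is -1, although one of
    them must be 1.\<close>
  then have "circ (1/2) = 1" using cases[OF z(1)] \<alpha>(2)[OF z(1)] \<beta>(2)[OF z(1)] by metis
  then show False by (simp add: circ_def)
qed

section \<open>The loop is quantum nullhomotopic\<close>

text \<open>Going inwards, the two runs are separated while the depth rises from 0 to 1 and the lines are
  rotated while it rises from 1 to 2. Depth 2 is reached at radius 3/4, before a point can be off the
  base point in both circles, which requires that the real and the imaginary part are below 1/2.\<close>

definition depth :: "complex \<Rightarrow> real" where
  "depth w = 8 * (1 - cmod w)"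

definition split_level :: "complex \<Rightarrow> real" where
  "split_level w = clamp01 (depth w)"

definition turn :: "complex \<Rightarrow> real" where
  "turn w = (1 - clamp01 (depth w - 1)) * (pi / 2)"

definition disk_point :: "bool \<Rightarrow> real \<Rightarrow> complex \<Rightarrow> (bool \<times> complex) set" where
  "disk_point b k w = wedge_point b (runner k (split_level w) (if b then Re w else Im w))"

text \<open>A uniform formula for four moving points, two in each circle. Wherever the lines of two of them
  are not orthogonal, one of the two rests at the base point and contributes 0, so the formula always
  describes a pair of points on orthogonal lines; and its continuity is clear.\<close>

definition extension :: "complex \<Rightarrow> ((bool \<times> complex) set \<Rightarrow> complex) \<Rightarrow> complex mat" where
  "extension w a = (let c = a (wedge_point False 1) in mat 2 2 (\<lambda>(i,j). c * of_bool (i = j)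
     + (a (disk_point True 0 w) - c) * rank1 0 i j
     + (a (disk_point True 1 w) - c) * rank1 (turn w) i j
     + (a (disk_point False 0 w) - c) * rank1 (pi/2) i j
     + (a (disk_point False 1 w) - c) * rank1 (pi/2 - turn w) i j))"

lemma continuous_on_split_level_turn [continuous_intros]:
  "continuous_on S split_level" "continuous_on S turn"
  unfolding split_level_def[abs_def] turn_def[abs_def] depth_def by (intro continuous_intros)+

lemma disk_point_in_topspace [simp]: "disk_point b k w \<in> topspace S1_wedge_S1"
  unfolding disk_point_def by (intro wedge_point_in_topspace) simp

lemma continuous_on_disk_point:
  assumes "continuous_map S1_wedge_S1 euclidean a"
  shows "continuous_on S (\<lambda>w. a (disk_point b k w))"
proof -
  have 1: "continuous_on (sphere 0 1) (\<lambda>z. a (wedge_point b z))"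
    using continuous_map_compose[OF continuous_map_wedge_point assms, of b] by (simp add: o_def)
  have 2: "continuous_on S (\<lambda>w. runner k (split_level w) (if b then Re w else Im w))"
    by (cases b) (auto intro!: continuous_intros)
  show ?thesis
    unfolding disk_point_def by (rule continuous_on_compose2[OF 1 2]) auto
qed

section \<open>Where the moving points rest and where the lines are orthogonal\<close>

lemma disk_point_eq_base:
  assumes "1/2 \<le> \<bar>if b then Re w else Im w\<bar>" "0 \<le> k" "k \<le> 1"
  shows "disk_point b k w = wedge_point False 1"
proof -
  have "0 \<le> split_level w" by (simp add: split_level_def clamp01_def)
  then show ?thesis
    unfolding disk_point_def using assms wedge_point_1[of b] by (subst runner_eq_1) auto
qed

lemma disk_point_split:
  assumes "1 \<le> depth w"
  shows "disk_point b 0 w = wedge_point False 1 \<or> disk_point b 1 w = wedge_point False 1"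
proof -
  have "split_level w = 1" using assms by (simp add: split_level_def clamp01_def)
  then have "disk_point b 0 w = wedge_point b 1 \<or> disk_point b 1 w = wedge_point b 1"
    unfolding disk_point_def using runner_l_1[of "if b then Re w else Im w"] by (elim disjE; simp only: simp_thms)
  then show ?thesis unfolding wedge_point_1[of b] .
qed

lemma turn_outer: "depth w \<le> 1 \<Longrightarrow> turn w = pi / 2"
  by (simp add: turn_def clamp01_def)

lemma turn_inner:
  assumes "\<bar>Re w\<bar> < 1/2" "\<bar>Im w\<bar> < 1/2"
  shows "turn w = 0" "1 \<le> depth w"
proof -
  have "(Re w)\<^sup>2 \<le> (1/2)\<^sup>2" "(Im w)\<^sup>2 \<le> (1/2)\<^sup>2" using assms by (auto simp: abs_le_square_iff[symmetric])
  \<comment> \<open>The squared radius is at most 1/4 + 1/4, which is below 9/16. Hence the depth is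
    at least 2, where the rotation is complete.\<close>
  then have "(cmod w)\<^sup>2 \<le> (3/4)\<^sup>2" unfolding cmod_power2 by (simp add: power2_eq_square)
  then have "cmod w \<le> 3/4" by (rule power2_le_imp_le) simp
  then show "turn w = 0" "1 \<le> depth w" by (simp_all add: turn_def depth_def clamp01_def)
qed

lemma rank1_complement: "i < 2 \<Longrightarrow> j < 2 \<Longrightarrow> rank1 (pi/2) i j = of_bool (i = j) - rank1 0 i j"
  by (auto simp: rank1_def less_2_cases_iff)

text \<open>If one circle is at rest, then either the depth is at most 1 and the two lines of the
  other circle are orthogonal, or its runs are separated and at most one point is off the base, so
  that its line is arbitrary. If both circles may be active, the rotation is complete: the two
  points of the \<open>True\<close> circle share the line of angle 0, those of the
  \<open>False\<close> circle share the orthogonal line, and each line carries at most one point off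
  the base.\<close>

lemma extension_spectral:
  obtains \<sigma> x y where "x \<in> topspace S1_wedge_S1" "y \<in> topspace S1_wedge_S1"
    "extension w = (\<lambda>a. spectral \<sigma> (a x) (a y))"
proof -
  let ?o = "wedge_point False 1" and ?P = "\<lambda>b k. disk_point b k w"
  note simps = extension_def spectral_def Let_def rank1_complement algebra_simps
  consider (Im) "?P True 0 = ?o" "?P True 1 = ?o" | (Re) "?P False 0 = ?o" "?P False 1 = ?o"
    | (inner) "\<bar>Re w\<bar> < 1/2" "\<bar>Im w\<bar> < 1/2"
    using disk_point_eq_base[of True w] disk_point_eq_base[of False w] by force
  then show ?thesis
  proof cases
    case Im
    consider "depth w \<le> 1" | "?P False 0 = ?o" | "?P False 1 = ?o"
      using disk_point_split[of w False] by linarith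
    then show ?thesis
    proof cases
      case 1
      have "extension w = (\<lambda>a. spectral 0 (a (?P False 1)) (a (?P False 0)))"
        by (intro ext eq_matI) (auto simp: simps Im turn_outer[OF 1])
      then show ?thesis by (rule that[rotated 2]) auto
    next
      case 2
      have "extension w = (\<lambda>a. spectral (pi/2 - turn w) (a (?P False 1)) (a ?o))"
        by (intro ext eq_matI) (auto simp: simps Im 2)
      then show ?thesis by (rule that[rotated 2]) auto
    next
      case 3
      have "extension w = (\<lambda>a. spectral (pi/2) (a (?P False 0)) (a ?o))"
        by (intro ext eq_matI) (auto simp: simps Im 3)
      then show ?thesis by (rule that[rotated 2]) auto
    qed
  next
    case Re
    consider "depth w \<le> 1" | "?P True 0 = ?o" | "?P True 1 = ?o"
      using disk_point_split[of w True] by linarith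
    then show ?thesis
    proof cases
      case 1
      have "extension w = (\<lambda>a. spectral 0 (a (?P True 0)) (a (?P True 1)))"
        by (intro ext eq_matI) (auto simp: simps Re turn_outer[OF 1])
      then show ?thesis by (rule that[rotated 2]) auto
    next
      case 2
      have "extension w = (\<lambda>a. spectral (turn w) (a (?P True 1)) (a ?o))"
        by (intro ext eq_matI) (auto simp: simps Re 2)
      then show ?thesis by (rule that[rotated 2]) auto
    next
      case 3
      have "extension w = (\<lambda>a. spectral 0 (a (?P True 0)) (a ?o))"
        by (intro ext eq_matI) (auto simp: simps Re 3)
      then show ?thesis by (rule that[rotated 2]) auto
    qed
  next
    case inner
    note t = turn_inner[OF inner]
    \<comment> \<open>The two points of a circle now share a line and one of them rests, so together
      they act as the other one, with index k.\<close>
    have ex: "\<exists>k. \<forall>a. a (?P b 0) + a (?P b 1) = a (?P b k) + (a ?o :: complex)" for b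
    proof (cases "?P b 0 = ?o")
      case True
      then show ?thesis by (intro exI[of _ 1]) simp
    next
      case False
      then show ?thesis using disk_point_split[OF t(2), of b] by (intro exI[of _ 0]) simp
    qed
    obtain k l where k: "\<And>a. a (?P True 0) + a (?P True 1) = a (?P True k) + (a ?o :: complex)"
      and l: "\<And>a. a (?P False 0) + a (?P False 1) = a (?P False l) + (a ?o :: complex)"
      using ex[of True] ex[of False] by blast
    have "extension w a = spectral 0 (a (?P True k)) (a (?P False l))" for a
    proof (rule eq_matI)
      fix i j assume "i < dim_row (spectral 0 (a (?P True k)) (a (?P False l)))"
        "j < dim_col (spectral 0 (a (?P True k)) (a (?P False l)))"
      then have ij: "i < 2" "j < 2" by (auto simp: spectral_def)
      have "extension w a $$ (i,j) = a ?o * of_bool (i = j)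
          + (a (?P True 0) + a (?P True 1) - 2 * a ?o) * rank1 0 i j
          + (a (?P False 0) + a (?P False 1) - 2 * a ?o) * rank1 (pi/2) i j"
        using ij by (simp add: extension_def Let_def t(1) algebra_simps)
      also have "\<dots> = spectral 0 (a (?P True k)) (a (?P False l)) $$ (i,j)"
        unfolding k l using ij by (simp add: spectral_def rank1_complement algebra_simps)
      finally show "extension w a $$ (i,j) = \<dots>" .
    qed (auto simp: extension_def spectral_def Let_def)
    then have "extension w = (\<lambda>a. spectral 0 (a (?P True k)) (a (?P False l)))" by blast
    then show ?thesis by (rule that[rotated 2]) auto
  qed
qed

text \<open>At depth 0 the two points of each circle coincide and sit on orthogonal lines, so their
  projections add up to the identity and the matrix is scalar. One circle rests there, and its
  contribution cancels against the value at the base point.\<close>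

lemma extension_sphere:
  assumes "w \<in> sphere 0 1"
  shows "extension w a = a (commutator_loop w) \<cdot>\<^sub>m 1\<^sub>m 2"
proof -
  have d: "depth w = 0" using assms by (simp add: depth_def)
  then have l: "split_level w = 0" by (simp add: split_level_def clamp01_def)
  have t: "turn w = pi / 2" using d by (simp add: turn_outer)
  have p: "disk_point b 1 w = disk_point b 0 w" for b
    unfolding disk_point_def l by (subst runner_l_0) simp
  have e: "extension w a = (a (disk_point True 0 w) + a (disk_point False 0 w) - a (wedge_point False 1)) \<cdot>\<^sub>m 1\<^sub>m 2"
    by (rule eq_matI) (auto simp: extension_def Let_def t p rank1_complement algebra_simps)
  show ?thesis
  proof (cases "\<bar>Im w\<bar> \<le> 1/2")
    case True
    then have "disk_point True 0 w = wedge_point False 1"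
      using sphere_Re_Im(2)[OF assms] by (intro disk_point_eq_base) auto
    moreover have "disk_point False 0 w = commutator_loop w"
      using True by (simp add: disk_point_def commutator_loop_def l)
    ultimately show ?thesis using e by simp
  next
    case False
    then have "disk_point False 0 w = wedge_point False 1" by (intro disk_point_eq_base) auto
    moreover have "disk_point True 0 w = commutator_loop w"
      using False by (simp add: disk_point_def commutator_loop_def l)
    ultimately show ?thesis using e by simp
  qed
qed

theorem quantum_nullhomotopic_commutator_loop: "quantum_nullhomotopic S1_wedge_S1 commutator_loop"
  unfolding quantum_nullhomotopic_def
proof (intro exI conjI ballI)
  have D: "compact_space D2" and S: "compact_space S1" by (auto simp: compact_space_subtopology)
  have DS: "subtopology D2 (sphere 0 1) = S1" by (simp add: subtopology_subtopology Int_absorb1)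
  let ?\<phi> = "\<lambda>a. \<lambda>w\<in>topspace D2. extension w a" and ?r = "\<lambda>F. restrict F (sphere 0 1)"
  \<comment> \<open>The witnesses left open by \<open>exI\<close> are fixed by the statements that
    follow: H is the plane C^2, the tensor products are algebras of continuous matrix-valued
    functions, \<open>r\<close> is restriction to the circle, and the homomorphism from C(T) is
    \<open>extension\<close>.\<close>
  show "(0::nat) < 2" by simp
  show "cstar_tensor (C_alg D2) (L_alg 2) (cont_alg D2 (L_alg 2)) (elem_tensor D2)"
    by (rule cstar_tensor_cont_alg[OF D])
  show "cstar_tensor (C_alg S1) (L_alg 2) (cont_alg S1 (L_alg 2)) (elem_tensor S1)"
    by (rule cstar_tensor_cont_alg[OF S])
  show "?r \<in> star_hom (cont_alg D2 (L_alg 2)) (cont_alg S1 (L_alg 2))"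
    using star_hom_restrict_cont_alg[OF D, of "sphere 0 1" 2] S unfolding DS by auto
  show "?r (elem_tensor D2 a M) = elem_tensor S1 (pullback S1 id a) M" for a M
    by (auto simp: elem_tensor_def pullback_def restrict_def fun_eq_iff)
  show "?\<phi> \<in> star_hom (C_alg S1_wedge_S1) (cont_alg D2 (L_alg 2))"
  proof (rule star_hom_C_alg_pointwise[OF compact_space_S1_wedge_S1 D])
    show "extension w \<in> star_hom (C_alg S1_wedge_S1) (L_alg 2)" for w
    proof -
      obtain \<sigma> x y where "x \<in> topspace S1_wedge_S1" "y \<in> topspace S1_wedge_S1"
        "extension w = (\<lambda>a. spectral \<sigma> (a x) (a y))" by (rule extension_spectral)
      then show ?thesis by (simp only: star_hom_spectral)
    qed
    fix a and i j :: nat assume "a \<in> carrier (C_alg S1_wedge_S1)" and ij: "i < 2" "j < 2"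
    then have "continuous_map S1_wedge_S1 euclidean a" by (simp add: C_alg_def)
    note a = continuous_on_disk_point[OF this]
    have r: "continuous_on (cball 0 1) (\<lambda>w. rank1 (f w) i j)"
      if "continuous_on (cball 0 1) f" for f :: "complex \<Rightarrow> real" and i j
      unfolding rank1_def by (cases "i = 0"; cases "j = 0") (auto intro!: continuous_intros that)
    show "continuous_map D2 euclidean (\<lambda>w. extension w a $$ (i, j))"
      unfolding extension_def Let_def continuous_map_iff_continuous2[symmetric]
      using ij by (simp, intro conjI impI continuous_intros a r)
  qed
  show "?r (?\<phi> a) = elem_tensor S1 (pullback S1 commutator_loop a) \<one>\<^bsub>L_alg 2\<^esub>" for a
    by (auto simp: elem_tensor_def pullback_def restrict_def fun_eq_iff extension_sphere L_simps)
qed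

theorem corollary3p5:
  "\<exists>f. loop_in S1_wedge_S1 f \<and> quantum_nullhomotopic S1_wedge_S1 f \<and>
       \<not> nullhomotopic_loop S1_wedge_S1 f"
  using loop_in_commutator_loop quantum_nullhomotopic_commutator_loop not_nullhomotopic_commutator_loop
  by blast

end
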